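(* Let $d\ge1$ and $1\le k<d(d+1)$. If $G=(V,E)$ is a $k$-connected graph that is not rigid in $\mathbb{R}^d$, then $r_d(G)\ge m_{d,k}|V|$, where $m_{d,k}=\frac{k}{2}$ if $1\le k\le d$ and $m_{d,k}=d+\frac12-\frac12\cdot\frac{d(d+1)}{k}$ if $d+1\le k<d(d+1)$.
   Context: $r_d(G)$ is the rank of the $d$-dimensional rigidity matroid of $G$: the rank of the rigidity matrix of a generic framework $(G,p)$ in $\mathbb{R}^d$ (coordinates algebraically independent over $\mathbb{Q}$), whose row for edge $uv$ has $p(u)-p(v)$ in the $d$ columns of $u$, $p(v)-p(u)$ in those of $v$, zeros elsewhere. A graph is rigid in $\mathbb{R}^d$ if a generic framework of it is rigid, i.e. there is $\varepsilon>0$ such that every framework with the same edge lengths and each vertex moved by less than $\varepsilon$ has all pairwise distances unchanged. *)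

theory Defs
  imports "HOL-Analysis.Analysis"
begin

text \<open>
  The vertex set of a graph is the finite type \<open>'v\<close>, its edges are two-element subsets of \<open>'v\<close>,
  and the dimension is \<open>CARD('d)\<close>.
\<close>

definition simple_graph :: "'v set set \<Rightarrow> bool" where
  "simple_graph E \<longleftrightarrow> (\<forall>e\<in>E. card e = 2)"

definition induced_connected :: "'v set set \<Rightarrow> 'v set \<Rightarrow> bool" where
  "induced_connected E W \<longleftrightarrow>
     W \<noteq> {} \<and> (\<forall>u\<in>W. \<forall>v\<in>W. (u, v) \<in> {(x, y). x \<in> W \<and> y \<in> W \<and> {x, y} \<in> E}\<^sup>*)"

definition vertex_connected :: "nat \<Rightarrow> 'v::finite set set \<Rightarrow> bool" where
  "vertex_connected k E \<longleftrightarrow>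
     k < CARD('v) \<and> (\<forall>S :: 'v set. card S < k \<longrightarrow> induced_connected E (- S))"

text \<open>
  A polynomial with rational coefficients in the variables \<open>'i\<close> is given by a finite set \<open>M\<close> of
  exponent vectors and a coefficient \<open>c m\<close> for each \<open>m \<in> M\<close>.
\<close>

definition alg_independent_rat :: "('i::finite \<Rightarrow> real) \<Rightarrow> bool" where
  "alg_independent_rat x \<longleftrightarrow>
     (\<forall>(M :: ('i \<Rightarrow> nat) set) (c :: ('i \<Rightarrow> nat) \<Rightarrow> rat).
        finite M \<longrightarrow> (\<Sum>m\<in>M. of_rat (c m) * (\<Prod>i\<in>UNIV. x i ^ m i)) = 0 \<longrightarrow>
        (\<forall>m\<in>M. c m = 0))"

definition generic_placement :: "('v::finite \<Rightarrow> real ^ 'd) \<Rightarrow> bool" where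
  "generic_placement p \<longleftrightarrow> alg_independent_rat (\<lambda>(v, i). p v $ i)"

text \<open>
  Rows are indexed by all sets of vertices; those that are not edges give zero rows, which do not
  affect the rank. In the row of an edge \<open>e\<close> containing \<open>w\<close>, the description picks the other end of \<open>e\<close>.
\<close>

definition rigidity_matrix ::
  "'v::finite set set \<Rightarrow> ('v \<Rightarrow> real ^ 'd) \<Rightarrow> real ^ ('v \<times> 'd) ^ ('v set)" where
  "rigidity_matrix E p =
     (\<chi> e. \<chi> c. case c of (w, i) \<Rightarrow>
        if e \<in> E \<and> w \<in> e then (p w - p (THE u. e = {w, u})) $ i else 0)"

text \<open>The rank does not depend on the choice of the generic placement.\<close>

definition rigidity_rank :: "'d::finite itself \<Rightarrow> 'v::finite set set \<Rightarrow> nat" where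
  "rigidity_rank _ E =
     rank (rigidity_matrix E (SOME p :: 'v \<Rightarrow> real ^ 'd. generic_placement p))"

definition rigid_framework :: "'v set set \<Rightarrow> ('v \<Rightarrow> real ^ 'd) \<Rightarrow> bool" where
  "rigid_framework E p \<longleftrightarrow>
     (\<exists>\<epsilon>>0. \<forall>q :: 'v \<Rightarrow> real ^ 'd.
        (\<forall>u v. {u, v} \<in> E \<longrightarrow> dist (q u) (q v) = dist (p u) (p v)) \<and>
        (\<forall>v. dist (q v) (p v) < \<epsilon>) \<longrightarrow>
        (\<forall>u v. dist (q u) (q v) = dist (p u) (p v)))"

definition rigid_graph :: "'d::finite itself \<Rightarrow> 'v::finite set set \<Rightarrow> bool" where
  "rigid_graph _ E \<longleftrightarrow> (\<exists>p :: 'v \<Rightarrow> real ^ 'd. generic_placement p \<and> rigid_framework E p)"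

definition rank_density :: "nat \<Rightarrow> nat \<Rightarrow> real" where
  "rank_density d k =
     (if k \<le> d then real k / 2
      else real d + 1 / 2 - 1 / 2 * (real (d * (d + 1)) / real k))"

end

theory Submission
  imports Defs
begin

text \<open>
  Fix a generic placement \<open>p\<close> and pass to the closure of the graph, joining two vertices whenever
  their row lies in the span of the rows of \<open>E\<close>; this changes neither the rank nor non-rigidity and keeps
  \<open>k\<close>-connectivity. In the closure two cliques with at least \<open>d\<close> common vertices merge into one.

  Add the vertices one at a time in a uniformly random order. A vertex whose set of earlier neighbours
  is \<open>A\<close> raises the rank by at least \<open>min |A| d\<close> (0-extension), and by \<open>d + 1\<close> if \<open>|A| > d\<close> and \<open>A\<close> is not a
  clique (1-extension). Given \<open>|A| = j\<close>, which is uniform on \<open>0, ..., D\<close> for a vertex of degree \<open>D\<close>, the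
  set \<open>A\<close> is a random \<open>j\<close>-subset of the neighbourhood; if the neighbourhood is not a clique and \<open>j > d\<close>,
  then \<open>A\<close> is not a clique with probability at least \<open>j / D\<close>. The resulting expected increase is
  \<open>d + 1/2 - d (d + 1) / (2 D)\<close>, which is at least \<open>m\<^sub>d\<^sub>,\<^sub>k\<close> because \<open>D \<ge> k\<close>. A vertex whose
  neighbourhood is a clique can be removed beforehand: it contributes \<open>d \<ge> m\<^sub>d\<^sub>,\<^sub>k\<close> when it is put back last.
\<close>

section \<open>Rational polynomials and generic points\<close>

definition monomial :: "('i::finite \<Rightarrow> nat) \<Rightarrow> ('i \<Rightarrow> real) \<Rightarrow> real" where
  "monomial m x = (\<Prod>i\<in>UNIV. x i ^ m i)"

text \<open>Polynomiality is a property of the function, the representation being hidden, so closure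
  under sums, products and determinants replaces polynomial arithmetic.\<close>

definition rat_poly :: "(('i::finite \<Rightarrow> real) \<Rightarrow> real) \<Rightarrow> bool" where
  "rat_poly f \<longleftrightarrow> (\<exists>M c. finite M \<and> (\<forall>x. f x = (\<Sum>m\<in>M. of_rat (c m) * monomial m x)))"

lemma rat_polyI:
  assumes "finite M" "\<And>x. f x = (\<Sum>m\<in>M. of_rat (c m) * monomial m x)"
  shows "rat_poly f"
  unfolding rat_poly_def using assms by blast

lemma rat_poly_const: "rat_poly (\<lambda>x. of_rat a)"
  by (rule rat_polyI[of "{\<lambda>_. 0}" _ "\<lambda>_. a"]) (auto simp: monomial_def)

lemma rat_poly_0 [simp]: "rat_poly (\<lambda>x. 0)" and rat_poly_1 [simp]: "rat_poly (\<lambda>x. 1)"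
  using rat_poly_const[of 0] rat_poly_const[of 1] by simp_all

lemma rat_poly_var: "rat_poly (\<lambda>x. x i)"
proof (rule rat_polyI[of "{\<lambda>j. if j = i then 1 else 0}" _ "\<lambda>_. 1"])
  fix x :: "'a \<Rightarrow> real"
  have "(\<Prod>j\<in>UNIV. x j ^ (if j = i then 1 else 0)) = (\<Prod>j\<in>UNIV. if j = i then x j else 1)"
    by (intro prod.cong) auto
  then show "x i = (\<Sum>m\<in>{\<lambda>j. if j = i then 1 else 0}. of_rat 1 * monomial m x)"
    by (simp add: monomial_def)
qed simp

lemma rat_poly_add:
  assumes "rat_poly f" "rat_poly g"
  shows "rat_poly (\<lambda>x. f x + g x)"
proof -
  obtain M c where M: "finite M" "\<And>x. f x = (\<Sum>m\<in>M. of_rat (c m) * monomial m x)"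
    using assms(1) unfolding rat_poly_def by blast
  obtain M' c' where M': "finite M'" "\<And>x. g x = (\<Sum>m\<in>M'. of_rat (c' m) * monomial m x)"
    using assms(2) unfolding rat_poly_def by blast
  let ?a = "\<lambda>m. if m \<in> M then c m else 0" and ?b = "\<lambda>m. if m \<in> M' then c' m else 0"
  show ?thesis
  proof (rule rat_polyI[of "M \<union> M'" _ "\<lambda>m. ?a m + ?b m"])
    fix x
    have "f x = (\<Sum>m\<in>M \<union> M'. of_rat (?a m) * monomial m x)"
      unfolding M(2) using M(1) M'(1) by (intro sum.mono_neutral_cong_left) auto
    moreover have "g x = (\<Sum>m\<in>M \<union> M'. of_rat (?b m) * monomial m x)"
      unfolding M'(2) using M(1) M'(1) by (intro sum.mono_neutral_cong_left) auto
    ultimately show "f x + g x = (\<Sum>m\<in>M \<union> M'. of_rat (?a m + ?b m) * monomial m x)"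
      by (simp add: of_rat_add distrib_right sum.distrib)
  qed (use M M' in auto)
qed

lemma rat_poly_sum:
  assumes "\<And>k. k \<in> K \<Longrightarrow> rat_poly (f k)"
  shows "rat_poly (\<lambda>x. \<Sum>k\<in>K. f k x)"
  using assms by (induction K rule: infinite_finite_induct) (auto intro: rat_poly_add)

lemma monomial_add: "monomial (\<lambda>i. a i + b i) x = monomial a x * monomial b x"
  by (simp add: monomial_def power_add prod.distrib)

lemma rat_poly_mult_term:
  assumes "rat_poly f"
  shows "rat_poly (\<lambda>x. of_rat b * monomial m x * f x)"
proof -
  obtain M c where M: "finite M" "\<And>x. f x = (\<Sum>m\<in>M. of_rat (c m) * monomial m x)"
    using assms(1) unfolding rat_poly_def by blast
  have "rat_poly (\<lambda>x. of_rat (b * c n) * monomial (\<lambda>i. m i + n i) x)" for n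
    by (rule rat_polyI[of "{\<lambda>i. m i + n i}" _ "\<lambda>_. b * c n"]) auto
  then have "rat_poly (\<lambda>x. \<Sum>n\<in>M. of_rat (b * c n) * monomial (\<lambda>i. m i + n i) x)"
    by (intro rat_poly_sum)
  then show ?thesis
    unfolding M(2) by (simp add: monomial_add of_rat_mult sum_distrib_left mult_ac)
qed

lemma rat_poly_mult:
  assumes "rat_poly f" "rat_poly g"
  shows "rat_poly (\<lambda>x. f x * g x)"
proof -
  obtain M c where M: "finite M" "\<And>x. f x = (\<Sum>m\<in>M. of_rat (c m) * monomial m x)"
    using assms(1) unfolding rat_poly_def by blast
  have "rat_poly (\<lambda>x. \<Sum>m\<in>M. of_rat (c m) * monomial m x * g x)"
    by (intro rat_poly_sum rat_poly_mult_term assms)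
  then show ?thesis by (simp add: M(2) sum_distrib_right)
qed

lemma rat_poly_diff:
  assumes "rat_poly f" "rat_poly g"
  shows "rat_poly (\<lambda>x. f x - g x)"
  using rat_poly_add[OF assms(1) rat_poly_mult[OF rat_poly_const[of "-1"] assms(2)]] by simp

lemma rat_poly_prod:
  assumes "\<And>k. k \<in> K \<Longrightarrow> rat_poly (f k)"
  shows "rat_poly (\<lambda>x. \<Prod>k\<in>K. f k x)"
  using assms by (induction K rule: infinite_finite_induct) (auto intro: rat_poly_mult)

lemma rat_poly_det:
  fixes A :: "('i::finite \<Rightarrow> real) \<Rightarrow> real^'n^'n"
  assumes "\<And>a b. rat_poly (\<lambda>x. A x $ a $ b)"
  shows "rat_poly (\<lambda>x. det (A x))"
proof -
  have "rat_poly (\<lambda>x. of_int (sign p) :: real)" for p :: "'n \<Rightarrow> 'n"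
    using rat_poly_const[of "of_int (sign p)"] by simp
  then show ?thesis
    unfolding det_def by (intro rat_poly_sum rat_poly_mult rat_poly_prod assms)
qed

text \<open>Algebraic independence makes every coefficient zero. Read contrapositively, a rational
  polynomial that is nonzero at one convenient point is nonzero at each generic point.\<close>

lemma rat_poly_eq_0:
  assumes "rat_poly f" "alg_independent_rat x" "f x = 0"
  shows "f y = 0"
proof -
  obtain M c where M: "finite M" "\<And>x. f x = (\<Sum>m\<in>M. of_rat (c m) * monomial m x)"
    using assms(1) unfolding rat_poly_def by blast
  have "\<forall>m\<in>M. c m = 0"
    using assms(2,3) M unfolding alg_independent_rat_def monomial_def by auto
  then show ?thesis by (simp add: M(2))
qed

lemma rat_poly_nonzero_nearby:
  assumes "rat_poly f"
  shows "\<exists>e>0. \<forall>y. (\<forall>i. \<bar>y i - x i\<bar> < e) \<longrightarrow> f x \<noteq> 0 \<longrightarrow> f y \<noteq> 0"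
proof (cases "f x = 0")
  case False
  obtain M c where M: "finite M" "\<And>x. f x = (\<Sum>m\<in>M. of_rat (c m) * monomial m x)"
    using assms(1) unfolding rat_poly_def by blast
  have "continuous_on UNIV f"
    unfolding M(2) monomial_def by (intro continuous_intros continuous_on_product_coordinates)
  then have "open (f -` (- {0}))"
    by (intro open_vimage) auto
  moreover have "x \<in> f -` (- {0})" using False by simp
  ultimately obtain X where X: "x \<in> Pi\<^sub>E UNIV X" "\<And>i. open (X i)" "Pi\<^sub>E UNIV X \<subseteq> f -` (- {0})"
    using product_topology_open_contains_basis[of "\<lambda>_. euclidean" UNIV "f -` (- {0})" x]
    unfolding open_fun_def by auto
  have "\<exists>e>0. ball (x i) e \<subseteq> X i" for i
    using X(1) X(2)[of i] open_contains_ball by (metis PiE_mem UNIV_I)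
  then obtain e where e: "\<And>i. e i > 0" "\<And>i. ball (x i) (e i) \<subseteq> X i" by metis
  show ?thesis
  proof (intro exI conjI allI impI)
    show "0 < Min (range e)" using e by simp
    fix y assume y: "\<forall>i. \<bar>y i - x i\<bar> < Min (range e)"
    have "y i \<in> X i" for i
    proof -
      have "\<bar>y i - x i\<bar> < e i" using y[rule_format, of i] Min_le[of "range e" "e i"] by simp
      then show ?thesis using e(2)[of i] by (auto simp: dist_real_def subset_iff abs_minus_commute)
    qed
    then show "f y \<noteq> 0" using X(3) by auto
  qed
qed (auto intro: exI[of _ 1])

section \<open>Independent families of vectors with polynomial entries\<close>

text \<open>Indexing matters: a repeated vector counts as a dependence, so \<open>card K\<close>
  bounds the dimension from below without an injectivity assumption.\<close>

definition indep_family :: "'k set \<Rightarrow> ('k \<Rightarrow> 'a::real_vector) \<Rightarrow> bool" where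
  "indep_family K a \<longleftrightarrow> (\<forall>c. (\<Sum>k\<in>K. c k *\<^sub>R a k) = 0 \<longrightarrow> (\<forall>k\<in>K. c k = 0))"

lemma indep_familyD: "indep_family K a \<Longrightarrow> (\<Sum>k\<in>K. c k *\<^sub>R a k) = 0 \<Longrightarrow> k \<in> K \<Longrightarrow> c k = 0"
  unfolding indep_family_def by blast

text \<open>The Gram matrix of the vectors in \<open>K\<close>, padded by the identity so that it is indexed by the whole type.\<close>

definition gram :: "'k::finite set \<Rightarrow> ('k \<Rightarrow> real^'n) \<Rightarrow> real^'k^'k" where
  "gram K a = (\<chi> k l. if k \<in> K \<and> l \<in> K then a k \<bullet> a l else if k = l then 1 else 0)"

text \<open>A kernel vector vanishes outside \<open>K\<close>, and its combination of the
  \<open>a k\<close> is orthogonal to each \<open>a k\<close>, hence to itself. Independence thus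
  becomes the nonvanishing of one determinant, to which genericity and continuity apply.\<close>

lemma det_gram_iff: "det (gram K a) \<noteq> 0 \<longleftrightarrow> indep_family K a"
proof -
  have mult: "(gram K a *v c) $ k = (if k \<in> K then a k \<bullet> (\<Sum>l\<in>K. c $ l *\<^sub>R a l) else c $ k)" for c k
  proof (cases "k \<in> K")
    case True
    have "(gram K a *v c) $ k = (\<Sum>l\<in>UNIV. if l \<in> K then (a k \<bullet> a l) * c $ l else 0)"
      unfolding matrix_vector_mult_def using True by (auto simp: gram_def intro!: sum.cong)
    also have "\<dots> = (\<Sum>l\<in>K. (a k \<bullet> a l) * c $ l)"
      by (simp add: sum.If_cases)
    finally show ?thesis using True by (simp add: inner_sum_right mult.commute)
  next
    case False
    have "(gram K a *v c) $ k = (\<Sum>l\<in>UNIV. if k = l then c $ l else 0)"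
      unfolding matrix_vector_mult_def vec_lambda_beta using False
      by (intro sum.cong) (auto simp: gram_def)
    then show ?thesis using False by simp
  qed
  have "det (gram K a) \<noteq> 0 \<longleftrightarrow> (\<forall>c. gram K a *v c = 0 \<longrightarrow> c = 0)"
    using invertible_det_nz[of "gram K a"] invertible_left_inverse[of "gram K a"]
      matrix_left_invertible_ker[of "gram K a"] by simp
  also have "\<dots> \<longleftrightarrow> indep_family K a"
  proof
    assume ker: "\<forall>c. gram K a *v c = 0 \<longrightarrow> c = 0"
    show "indep_family K a"
      unfolding indep_family_def
    proof (intro allI impI)
      fix c assume c: "(\<Sum>k\<in>K. c k *\<^sub>R a k) = 0"
      define c' where "c' = (\<chi> k. if k \<in> K then c k else 0)"
      have "(\<Sum>l\<in>K. c' $ l *\<^sub>R a l) = 0"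
        using c by (simp add: c'_def cong: sum.cong)
      then have "(gram K a *v c') $ k = 0" for k
        unfolding mult by (simp add: c'_def)
      then have "gram K a *v c' = 0" by (simp add: vec_eq_iff)
      then have "c' = 0" using ker by blast
      moreover have "c' $ k = c k" if "k \<in> K" for k using that by (simp add: c'_def)
      ultimately show "\<forall>k\<in>K. c k = 0" by simp
    qed
  next
    assume ind: "indep_family K a"
    show "\<forall>c. gram K a *v c = 0 \<longrightarrow> c = 0"
    proof (intro allI impI)
      fix c assume c: "gram K a *v c = 0"
      let ?s = "\<Sum>l\<in>K. c $ l *\<^sub>R a l"
      have "a k \<bullet> ?s = 0" if "k \<in> K" for k
        using mult[of c k] that unfolding c by simp
      then have "?s \<bullet> ?s = 0"
        by (subst (1) inner_sum_left) simp
      then have "?s = 0" by simp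
      then have "\<forall>k\<in>K. c $ k = 0"
        using indep_familyD[OF ind, of "\<lambda>l. c $ l"] by blast
      moreover have "c $ k = 0" if "k \<notin> K" for k
        using mult[of c k] that unfolding c by simp
      ultimately show "c = 0" unfolding vec_eq_iff by auto
    qed
  qed
  finally show ?thesis .
qed

lemma rat_poly_det_gram:
  assumes "\<And>k n. rat_poly (\<lambda>x. a x k $ n)"
  shows "rat_poly (\<lambda>x. det (gram K (a x)))"
proof (rule rat_poly_det)
  fix k l
  have "rat_poly (\<lambda>x. a x k \<bullet> a x l)"
    unfolding inner_vec_def inner_real_def by (intro rat_poly_sum rat_poly_mult assms)
  then show "rat_poly (\<lambda>x. gram K (a x) $ k $ l)"
    by (cases "k \<in> K \<and> l \<in> K") (auto simp: gram_def)
qed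

lemma indep_family_generic:
  fixes a :: "('i::finite \<Rightarrow> real) \<Rightarrow> 'k::finite \<Rightarrow> real^'n"
  assumes "\<And>k n. rat_poly (\<lambda>x. a x k $ n)" "alg_independent_rat x" "indep_family K (a y)"
  shows "indep_family K (a x)"
  using rat_poly_eq_0[OF rat_poly_det_gram[of a K] assms(2), of y] assms
  by (auto simp flip: det_gram_iff)

lemma indep_family_nearby:
  fixes a :: "('i::finite \<Rightarrow> real) \<Rightarrow> 'k::finite \<Rightarrow> real^'n"
  assumes "\<And>k n. rat_poly (\<lambda>x. a x k $ n)" "indep_family K (a x)"
  shows "\<exists>e>0. \<forall>y. (\<forall>i. \<bar>y i - x i\<bar> < e) \<longrightarrow> indep_family K (a y)"
  using rat_poly_nonzero_nearby[OF rat_poly_det_gram[of a K], of x] assms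
  by (auto simp flip: det_gram_iff)

lemma indep_family_mono:
  assumes "finite K" "indep_family K a" "L \<subseteq> K"
  shows "indep_family L a"
  unfolding indep_family_def
proof (intro allI impI)
  fix c assume c: "(\<Sum>k\<in>L. c k *\<^sub>R a k) = 0"
  have "(\<Sum>k\<in>K. (if k \<in> L then c k else 0) *\<^sub>R a k) = (\<Sum>k\<in>L. c k *\<^sub>R a k)"
    using assms by (intro sum.mono_neutral_cong_right) auto
  then have "(\<Sum>k\<in>K. (if k \<in> L then c k else 0) *\<^sub>R a k) = 0" using c by simp
  then show "\<forall>k\<in>L. c k = 0"
    using indep_familyD[OF assms(2), of "\<lambda>k. if k \<in> L then c k else 0"] assms(3) by fastforce
qed

lemma indep_family_imp_inj_independent:
  assumes "finite K" "indep_family K a"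
  shows "inj_on a K" "independent (a ` K)"
proof -
  show inj: "inj_on a K"
  proof (rule inj_onI, rule ccontr)
    fix k l assume kl: "k \<in> K" "l \<in> K" "a k = a l" "k \<noteq> l"
    have "(\<Sum>i\<in>{k, l}. (if i = k then 1 else -1) *\<^sub>R a i) = 0"
      using kl by simp
    moreover have "indep_family {k, l} a" using indep_family_mono[OF assms] kl by auto
    ultimately show False
      using indep_familyD[of "{k, l}" a "\<lambda>i. if i = k then 1 else -1" k] by simp
  qed
  show "independent (a ` K)"
  proof (rule independent_if_scalars_zero)
    fix f x assume f: "(\<Sum>x\<in>a ` K. f x *\<^sub>R x) = 0" and x: "x \<in> a ` K"
    then have "(\<Sum>k\<in>K. f (a k) *\<^sub>R a k) = 0" by (simp add: sum.reindex[OF inj])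
    then show "f x = 0" using assms(2) x unfolding indep_family_def by auto
  qed (use assms in auto)
qed

lemma indep_family_imp_card_le_dim:
  fixes a :: "'k \<Rightarrow> 'a::euclidean_space"
  assumes "finite K" "indep_family K a" "a ` K \<subseteq> span S"
  shows "card K \<le> dim S"
proof -
  note i = indep_family_imp_inj_independent[OF assms(1,2)]
  have "card K = card (a ` K)" using i(1) by (simp add: card_image)
  also have "\<dots> \<le> dim (span S)" using i(2) assms(3) by (intro independent_card_le_dim)
  finally show ?thesis by simp
qed

lemma independent_imp_indep_family:
  assumes "finite K" "inj_on a K" "independent (a ` K)"
  shows "indep_family K a"
  unfolding indep_family_def
proof (intro allI impI ballI)
  fix c k assume c: "(\<Sum>k\<in>K. c k *\<^sub>R a k) = 0" and k: "k \<in> K"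
  have "(\<Sum>x\<in>a ` K. c (inv_into K a x) *\<^sub>R x) = 0"
    using c assms(2) by (simp add: sum.reindex cong: sum.cong)
  then have "c (inv_into K a (a k)) = 0"
    using assms k by (intro independentD[of "a ` K" "a ` K" "\<lambda>x. c (inv_into K a x)"]) auto
  then show "c k = 0" using assms k by simp
qed

lemma ex_indep_family_basis:
  fixes a :: "'k \<Rightarrow> 'a::euclidean_space"
  assumes "finite F"
  obtains K where "K \<subseteq> F" "indep_family K a" "card K = dim (a ` F)"
proof -
  obtain B where B: "B \<subseteq> a ` F" "independent B" "a ` F \<subseteq> span B" "card B = dim (a ` F)"
    using basis_exists[of "a ` F"] by metis
  obtain K where K: "K \<subseteq> F" "inj_on a K" "a ` K = B"
    using subset_image_inj[of B a F] B(1) by auto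
  have "indep_family K a"
    using K B assms finite_subset by (intro independent_imp_indep_family) auto
  moreover have "card K = dim (a ` F)" using K B card_image by metis
  ultimately show ?thesis using that K by blast
qed

text \<open>A basis chosen at \<open>y\<close> stays independent at the generic point. Lower bounds
  on a generic rank may therefore be proved at a special position.\<close>

lemma dim_le_dim_generic:
  fixes a :: "('i::finite \<Rightarrow> real) \<Rightarrow> 'k::finite \<Rightarrow> real^'n"
  assumes "\<And>k n. rat_poly (\<lambda>x. a x k $ n)" "alg_independent_rat x"
  shows "dim (a y ` F) \<le> dim (a x ` F)"
proof -
  obtain K where K: "K \<subseteq> F" "indep_family K (a y)" "card K = dim (a y ` F)"
    using ex_indep_family_basis[of F "a y"] by auto
  then have "indep_family K (a x)" by (intro indep_family_generic[of a x K y] assms)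
  then have "card K \<le> dim (a x ` F)"
    using K by (intro indep_family_imp_card_le_dim[of K "a x"]) (auto intro: span_base)
  then show ?thesis using K by simp
qed

section \<open>Existence of algebraically independent points\<close>

text \<open>Algebraic independence of the coordinates in \<open>I\<close> alone, for an induction
  that chooses one coordinate after the other.\<close>

definition rat_independent_on :: "'i set \<Rightarrow> ('i::finite \<Rightarrow> real) \<Rightarrow> bool" where
  "rat_independent_on I x \<longleftrightarrow> (\<forall>M c. finite M \<longrightarrow> (\<forall>m\<in>M. \<forall>i. i \<notin> I \<longrightarrow> m i = 0) \<longrightarrow>
     (\<Sum>m\<in>M. of_rat (c m) * monomial m x) = 0 \<longrightarrow> (\<forall>m\<in>M. c m = 0))"

lemma monomial_fun_upd: "monomial m (x(i := t)) = monomial (m(i := 0)) x * t ^ m i"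
proof -
  have "monomial m (x(i := t)) = t ^ m i * (\<Prod>k\<in>UNIV - {i}. (x(i := t)) k ^ m k)"
    unfolding monomial_def by (subst prod.remove[of UNIV i]) auto
  also have "(\<Prod>k\<in>UNIV - {i}. (x(i := t)) k ^ m k) = (\<Prod>k\<in>UNIV - {i}. x k ^ (m(i := 0)) k)"
    by (intro prod.cong) auto
  also have "\<dots> = monomial (m(i := 0)) x"
    unfolding monomial_def by (simp add: prod.remove[of UNIV i])
  finally show ?thesis by (simp only: mult.commute)
qed

text \<open>Only countably many reals are roots of a nonzero polynomial in \<open>t\<close> whose
  coefficients are rational polynomials in the other coordinates; any other real can be the new
  coordinate.\<close>

lemma rat_independent_on_insert:
  assumes x: "rat_independent_on I x" and i: "i \<notin> I"
  shows "\<exists>t. rat_independent_on (insert i I) (x(i := t))"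
proof -
  \<comment> \<open>Polynomials are coded as lists of terms because these lists form a countable
    type, unlike the coefficient functions.\<close>
  define ev :: "(('a \<Rightarrow> nat) \<times> rat) list \<Rightarrow> real \<Rightarrow> real"
    where "ev L t = (\<Sum>(m, q)\<leftarrow>L. of_rat q * monomial m (x(i := t)))" for L t
  define bad where "bad = (\<Union>L\<in>{L. finite {t. ev L t = 0}}. {t. ev L t = 0})"
  have "countable bad"
    unfolding bad_def by (intro countable_UN) (auto intro: countable_finite)
  then obtain t where t: "t \<notin> bad"
    using uncountable_UNIV_real by (metis UNIV_I countable_subset subsetI)
  have "rat_independent_on (insert i I) (x(i := t))"
    unfolding rat_independent_on_def
  proof (intro allI impI ballI, rule ccontr)
    fix M c m0
    assume M: "finite M" "\<forall>m\<in>M. \<forall>k. k \<notin> insert i I \<longrightarrow> m k = 0"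
      and z: "(\<Sum>m\<in>M. of_rat (c m) * monomial m (x(i := t))) = 0"
      and m0: "m0 \<in> M" "c m0 \<noteq> 0"
    obtain ms where ms: "set ms = M" "distinct ms" using M(1) finite_distinct_list by blast
    define L where "L = map (\<lambda>m. (m, c m)) ms"
    have evL: "ev L s = (\<Sum>m\<in>M. of_rat (c m) * monomial m (x(i := s)))" for s
      unfolding ev_def L_def using ms by (simp add: sum_list_distinct_conv_sum_set comp_def)
    define n where "n = Max ((\<lambda>m. m i) ` M)"
    have n: "m i \<le> n" if "m \<in> M" for m using that M(1) by (simp add: n_def)
    define a where "a e = (\<Sum>m\<in>{m\<in>M. m i = e}. of_rat (c m) * monomial (m(i := 0)) x)" for e
    have poly: "ev L s = (\<Sum>e\<le>n. a e * s ^ e)" for s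
    proof -
      have "ev L s = (\<Sum>m\<in>M. of_rat (c m) * monomial (m(i := 0)) x * s ^ m i)"
        unfolding evL monomial_fun_upd by (simp add: mult.assoc)
      also have "\<dots> = (\<Sum>e\<le>n. \<Sum>m\<in>{m\<in>M. m i = e}. of_rat (c m) * monomial (m(i := 0)) x * s ^ m i)"
        using M(1) n by (intro sum.group[symmetric]) auto
      also have "\<dots> = (\<Sum>e\<le>n. a e * s ^ e)"
        unfolding a_def sum_distrib_right by (intro sum.cong) auto
      finally show ?thesis .
    qed
    \<comment> \<open>Erasing the exponent of \<open>i\<close> is injective on the monomials with
      exponent \<open>m0 i\<close>, so \<open>a (m0 i)\<close> is a rational polynomial in the
      coordinates of \<open>I\<close> with the nonzero coefficient \<open>c m0\<close>.\<close>
    have "a (m0 i) \<noteq> 0"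
    proof
      assume a0: "a (m0 i) = 0"
      let ?S = "{m\<in>M. m i = m0 i}"
      have inj: "inj_on (\<lambda>m. m(i := 0)) ?S"
        by (rule inj_onI) (metis (mono_tags, lifting) fun_upd_triv fun_upd_upd mem_Collect_eq)
      have restore: "(m(i := 0))(i := m0 i) = m" if "m \<in> ?S" for m
        using that by (auto simp: fun_eq_iff)
      have "(\<Sum>m\<in>(\<lambda>m. m(i := 0)) ` ?S. of_rat (c (m(i := m0 i))) * monomial m x) = a (m0 i)"
        unfolding a_def using restore by (subst sum.reindex[OF inj]) (auto intro!: sum.cong)
      moreover have "\<forall>m\<in>(\<lambda>m. m(i := 0)) ` ?S. \<forall>k. k \<notin> I \<longrightarrow> m k = 0"
        using M(2) by auto
      moreover have "finite ((\<lambda>m. m(i := 0)) ` ?S)" using M(1) by simp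
      ultimately have "\<forall>m\<in>(\<lambda>m. m(i := 0)) ` ?S. c (m(i := m0 i)) = 0"
        using x[unfolded rat_independent_on_def, THEN spec, THEN spec,
            of "(\<lambda>m. m(i := 0)) ` ?S" "\<lambda>m. c (m(i := m0 i))"] a0 by simp
      then have "c ((m0(i := 0))(i := m0 i)) = 0" using m0 by blast
      then show False using m0 by simp
    qed
    then have "finite {s. ev L s = 0}"
      unfolding poly using n[OF m0(1)] by (subst polyfun_finite_roots) auto
    moreover have "ev L t = 0" using z evL by simp
    ultimately have "t \<in> bad" unfolding bad_def by blast
    then show False using t by blast
  qed
  then show ?thesis by blast
qed

lemma ex_alg_independent_rat: "\<exists>x :: 'i::finite \<Rightarrow> real. alg_independent_rat x"
proof -
  have "\<exists>x :: 'i \<Rightarrow> real. rat_independent_on I x" for I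
    using finite[of I]
  proof (induction I rule: finite_induct)
    case empty
    have "rat_independent_on {} (\<lambda>_ :: 'i. 0)"
      unfolding rat_independent_on_def
    proof (intro allI impI ballI)
      fix M :: "('i \<Rightarrow> nat) set" and c m
      assume M: "\<forall>m\<in>M. \<forall>i. i \<notin> {} \<longrightarrow> m i = 0" and m: "m \<in> M"
        and z: "(\<Sum>m\<in>M. of_rat (c m) * monomial m (\<lambda>_. 0)) = 0"
      have "n = (\<lambda>_. 0)" if "n \<in> M" for n using M that by (auto simp: fun_eq_iff)
      then have "M = {m}" "m = (\<lambda>_. 0)" using m by auto
      then show "c m = 0" using z by (simp add: monomial_def)
    qed
    then show ?case by blast
  next
    case (insert i I)
    then show ?case using rat_independent_on_insert by blast
  qed
  from this[of UNIV] show ?thesis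
    unfolding rat_independent_on_def alg_independent_rat_def monomial_def by auto
qed

section \<open>Rows of the rigidity matrix\<close>

definition coords :: "('v \<Rightarrow> real^'d) \<Rightarrow> 'v \<times> 'd \<Rightarrow> real" where
  "coords p = (\<lambda>(v, i). p v $ i)"

definition placement :: "('v \<times> 'd \<Rightarrow> real) \<Rightarrow> 'v \<Rightarrow> real^'d" where
  "placement x = (\<lambda>v. \<chi> i. x (v, i))"

lemma placement_coords [simp]: "placement (coords p) = p"
  by (simp add: placement_def coords_def fun_eq_iff vec_eq_iff)

lemma generic_placement_iff: "generic_placement p \<longleftrightarrow> alg_independent_rat (coords p)"
  by (simp add: generic_placement_def coords_def)

lemma ex_generic_placement: "\<exists>p :: 'v::finite \<Rightarrow> real^'d. generic_placement p"
proof -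
  obtain x :: "'v \<times> 'd \<Rightarrow> real" where "alg_independent_rat x" using ex_alg_independent_rat by blast
  moreover have "coords (placement x) = x" by (auto simp: coords_def placement_def)
  ultimately show ?thesis unfolding generic_placement_iff by metis
qed

definition at_vertex :: "'v::finite \<Rightarrow> real^'d \<Rightarrow> real^('v \<times> 'd)" where
  "at_vertex u x = (\<chi> c. if fst c = u then x $ snd c else 0)"

definition vertex_part :: "'v::finite \<Rightarrow> real^('v \<times> 'd) \<Rightarrow> real^'d" where
  "vertex_part u h = (\<chi> i. h $ (u, i))"

definition pair_row :: "('v::finite \<Rightarrow> real^'d) \<Rightarrow> 'v \<Rightarrow> 'v \<Rightarrow> real^('v \<times> 'd)" where
  "pair_row p u v = at_vertex u (p u - p v) + at_vertex v (p v - p u)"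

text \<open>Taking all sets as edges makes the row independent of the graph; the matrix of
  \<open>E\<close> then only selects rows.\<close>

definition edge_row :: "('v::finite \<Rightarrow> real^'d) \<Rightarrow> 'v set \<Rightarrow> real^('v \<times> 'd)" where
  "edge_row p e = rigidity_matrix UNIV p $ e"

lemma linear_at_vertex: "linear (at_vertex u)"
  by (rule linearI) (auto simp: at_vertex_def vec_eq_iff)

lemma linear_vertex_part: "linear (vertex_part u)"
  by (rule linearI) (auto simp: vertex_part_def vec_eq_iff)

lemma vertex_part_at_vertex: "vertex_part w (at_vertex u x) = (if w = u then x else 0)"
  by (auto simp: vertex_part_def at_vertex_def vec_eq_iff)

lemma inner_at_vertex: "at_vertex u x \<bullet> h = x \<bullet> vertex_part u h"
proof -
  have "at_vertex u x \<bullet> h = (\<Sum>c\<in>UNIV \<times> UNIV. if fst c = u then x $ snd c * h $ c else 0)"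
    unfolding inner_vec_def at_vertex_def UNIV_Times_UNIV by (intro sum.cong) auto
  also have "\<dots> = (\<Sum>w\<in>UNIV. \<Sum>i\<in>UNIV. if w = u then x $ i * h $ (w, i) else 0)"
    by (subst sum.cartesian_product) (auto intro!: sum.cong)
  also have "\<dots> = (\<Sum>w\<in>UNIV. if w = u then \<Sum>i\<in>UNIV. x $ i * h $ (w, i) else 0)"
    by (intro sum.cong) auto
  finally show ?thesis by (simp add: inner_vec_def vertex_part_def)
qed

lemma pair_row_commute: "pair_row p u v = pair_row p v u"
  by (simp add: pair_row_def)

lemma pair_row_self [simp]: "pair_row p u u = 0"
  by (simp add: pair_row_def linear_0[OF linear_at_vertex])

text \<open>With \<open>h\<close> read as a velocity of the vertices, this is half the derivative of
  the squared distance between \<open>u\<close> and \<open>v\<close>.\<close>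

lemma inner_pair_row: "pair_row p u v \<bullet> h = (p u - p v) \<bullet> (vertex_part u h - vertex_part v h)"
  by (simp add: pair_row_def inner_add_left inner_at_vertex inner_diff_left inner_diff_right)

lemma edge_row_pair:
  assumes "u \<noteq> v"
  shows "edge_row p {u, v} = pair_row p u v"
proof -
  have "(THE w. {u, v} = {u, w}) = v" "(THE w. {u, v} = {v, w}) = u"
    using assms by (auto simp: doubleton_eq_iff)
  then show ?thesis using assms
    by (auto simp: edge_row_def rigidity_matrix_def pair_row_def at_vertex_def vec_eq_iff split: prod.split)
qed

lemma rank_rigidity_matrix: "rank (rigidity_matrix E p) = dim (edge_row p ` E)"
proof -
  have row: "row e (rigidity_matrix E p) = (if e \<in> E then edge_row p e else 0)" for e
    by (auto simp: row_def edge_row_def rigidity_matrix_def vec_eq_iff)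
  have "dim (edge_row p ` E) \<le> dim (rows (rigidity_matrix E p))"
  proof (rule dim_subset, clarify)
    fix e assume "e \<in> E"
    then have "edge_row p e = row e (rigidity_matrix E p)" using row[of e] by simp
    then show "edge_row p e \<in> rows (rigidity_matrix E p)" by (auto simp: rows_def)
  qed
  moreover have "dim (rows (rigidity_matrix E p)) \<le> dim (insert 0 (edge_row p ` E))"
    by (intro dim_subset) (auto simp: rows_def row)
  ultimately show ?thesis by (simp add: row_rank_def dim_insert span_zero)
qed

lemma rat_poly_edge_row: "rat_poly (\<lambda>x. edge_row (placement x) e $ c)"
proof (cases c)
  case (Pair w i)
  have "rat_poly (\<lambda>x. x (w, i) - x (THE u. e = {w, u}, i))"
    by (intro rat_poly_diff rat_poly_var)
  then show ?thesis
    by (cases "w \<in> e") (auto simp: Pair edge_row_def rigidity_matrix_def placement_def)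
qed

lemma dim_edge_row_le_generic:
  fixes p q :: "'v::finite \<Rightarrow> real^'d"
  assumes "generic_placement p"
  shows "dim (edge_row q ` F) \<le> dim (edge_row p ` F)"
  using dim_le_dim_generic[of "\<lambda>x. edge_row (placement x)" "coords p" "coords q" F] assms
  by (simp add: rat_poly_edge_row generic_placement_iff)

text \<open>By genericity one example suffices: \<open>v\<close> at the origin and the vertices of
  \<open>T\<close> at distinct unit vectors.\<close>

lemma indep_family_generic_differences:
  fixes p :: "'v::finite \<Rightarrow> real^'d"
  assumes p: "generic_placement p" and T: "card T \<le> CARD('d)" "v \<notin> T"
  shows "indep_family T (\<lambda>u. p v - p u)"
proof -
  obtain \<sigma> :: "'v \<Rightarrow> 'd" where \<sigma>: "inj_on \<sigma> T"
    using card_le_inj[of T "UNIV :: 'd set"] T by auto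
  define a :: "('v \<times> 'd \<Rightarrow> real) \<Rightarrow> 'v \<Rightarrow> real^'d" where "a x u = (\<chi> i. x (v, i) - x (u, i))" for x u
  define y where "y = (\<lambda>(w, i). if w \<in> T \<and> i = \<sigma> w then 1 else 0 :: real)"
  have ay: "a y u $ i = (if i = \<sigma> u then -1 else 0)" if "u \<in> T" for u i
    using that T by (auto simp: a_def y_def)
  have "indep_family T (a y)"
    unfolding indep_family_def
  proof (intro allI impI ballI)
    fix c k assume c: "(\<Sum>u\<in>T. c u *\<^sub>R a y u) = 0" and k: "k \<in> T"
    have "0 = (\<Sum>u\<in>T. c u *\<^sub>R a y u) $ \<sigma> k" using c by simp
    also have "\<dots> = (\<Sum>u\<in>T. if u = k then - c u else 0)"
      unfolding sum_component using \<sigma> k by (intro sum.cong) (auto simp: ay inj_on_def)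
    finally show "c k = 0" using k by simp
  qed
  then have "indep_family T (a (coords p))"
    using p by (intro indep_family_generic[of a "coords p" T y])
      (auto simp: a_def generic_placement_iff intro!: rat_poly_diff rat_poly_var)
  moreover have "a (coords p) = (\<lambda>u. p v - p u)"
    by (simp add: a_def coords_def fun_eq_iff vec_eq_iff)
  ultimately show ?thesis by simp
qed

text \<open>Infinitesimal rigidity gives rigidity because \<open>|q u - q v|\<^sup>2 - |p u - p v|\<^sup>2\<close> is twice the inner
  product of the displacement \<open>q - p\<close> with the row of \<open>uv\<close> at the midpoint of \<open>p\<close> and \<open>q\<close>, where the
  rank is still the generic one.\<close>

lemma rigid_framework_if_rows_span:
  fixes p :: "'v::finite \<Rightarrow> real^'d"
  assumes p: "generic_placement p" and E: "simple_graph E"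
    and span: "\<And>u v. pair_row p u v \<in> span (edge_row p ` E)"
  shows "rigid_framework E p"
proof -
  define C where "C = {e :: 'v set. card e = 2}"
  have EC: "E \<subseteq> C" using E by (auto simp: simple_graph_def C_def)
  obtain K where K: "K \<subseteq> E" "indep_family K (edge_row p)" "card K = dim (edge_row p ` E)"
    using ex_indep_family_basis[of E "edge_row p"] by auto
  have "edge_row p ` C \<subseteq> span (edge_row p ` E)"
    using span by (auto simp: C_def card_2_iff edge_row_pair)
  then have "dim (edge_row p ` C) \<le> card K" by (metis K(3) dim_span dim_subset)
  then have dimC: "dim (edge_row m ` C) \<le> card K" for m :: "'v \<Rightarrow> real^'d"
    using dim_edge_row_le_generic[OF p, of m C] by simp
  obtain \<epsilon> where \<epsilon>: "\<epsilon> > 0"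
    "\<And>y. (\<forall>c. \<bar>y c - coords p c\<bar> < \<epsilon>) \<Longrightarrow> indep_family K (edge_row (placement y))"
    using indep_family_nearby[of "\<lambda>x. edge_row (placement x)" K "coords p"] K(2)
    by (auto simp: rat_poly_edge_row)
  have "dist (q u) (q v) = dist (p u) (p v)"
    if q: "\<And>u v. {u, v} \<in> E \<Longrightarrow> dist (q u) (q v) = dist (p u) (p v)" "\<And>v. dist (q v) (p v) < \<epsilon>"
    for q :: "'v \<Rightarrow> real^'d" and u v
  proof -
    define m where "m v = (1 / 2) *\<^sub>R (p v + q v)" for v
    define h where "h = (\<chi> c. (q (fst c) - p (fst c)) $ snd c)"
    have part: "vertex_part u h = q u - p u" for u
      by (simp add: vertex_part_def h_def vec_eq_iff)
    have square_diff: "(x + y) \<bullet> (x - y) = x \<bullet> x - y \<bullet> y" for x y :: "real^'d"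
      by (simp add: inner_add_left inner_diff_right inner_commute[of y x])
    have len: "(dist (q u) (q v))\<^sup>2 - (dist (p u) (p v))\<^sup>2 = 2 * (pair_row m u v \<bullet> h)" for u v
    proof -
      have "m u - m v = (1 / 2) *\<^sub>R ((q u - q v) + (p u - p v))"
        by (simp add: m_def algebra_simps)
      moreover have "(q u - p u) - (q v - p v) = (q u - q v) - (p u - p v)" by simp
      ultimately have "2 * (pair_row m u v \<bullet> h)
          = ((q u - q v) + (p u - p v)) \<bullet> ((q u - q v) - (p u - p v))"
        unfolding inner_pair_row part by (simp only: inner_scaleR_left)
      also have "\<dots> = (q u - q v) \<bullet> (q u - q v) - (p u - p v) \<bullet> (p u - p v)"
        using square_diff[of "q u - q v" "p u - p v"] .
      finally show ?thesis by (simp add: dist_norm power2_norm_eq_inner)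
    qed
    have "\<bar>coords m c - coords p c\<bar> < \<epsilon>" for c
    proof -
      obtain w i where c: "c = (w, i)" by (cases c)
      have "m w - p w = (1 / 2) *\<^sub>R (q w - p w)"
        by (simp add: m_def vec_eq_iff field_simps)
      then have "norm (m w - p w) < \<epsilon>"
        using q(2)[of w] \<epsilon>(1) by (simp add: dist_norm)
      then show ?thesis
        using component_le_norm_cart[of "m w - p w" i] by (simp add: c coords_def)
    qed
    then have ind: "indep_family K (edge_row m)" using \<epsilon>(2)[of "coords m"] by simp
    \<comment> \<open>The rows of \<open>K\<close> are still independent at \<open>m\<close>, and no
      placement gives the complete graph a rank above \<open>card K\<close>; so they span all rows
      at \<open>m\<close>.\<close>
    have "edge_row m ` C \<subseteq> span (edge_row m ` K)"
    proof (rule card_ge_dim_independent)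
      show "edge_row m ` K \<subseteq> edge_row m ` C" using K EC by auto
      show "independent (edge_row m ` K)" "dim (edge_row m ` C) \<le> card (edge_row m ` K)"
        using indep_family_imp_inj_independent[OF _ ind] dimC[of m] by (auto simp: card_image)
    qed
    moreover have "span (edge_row m ` K) \<subseteq> {x. x \<bullet> h = 0}"
    proof (rule span_minimal)
      show "edge_row m ` K \<subseteq> {x. x \<bullet> h = 0}"
      proof clarify
        fix e assume "e \<in> K"
        then have "e \<in> E" "card e = 2" using K EC by (auto simp: C_def)
        then obtain u v where uv: "e = {u, v}" "u \<noteq> v" "{u, v} \<in> E" by (auto simp: card_2_iff)
        then show "edge_row m e \<bullet> h = 0" using len[of u v] q(1) by (simp add: edge_row_pair)
      qed
      show "subspace {x. x \<bullet> h = 0}" by (simp add: subspace_def inner_add_left)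
    qed
    ultimately have orth: "edge_row m e \<bullet> h = 0" if "e \<in> C" for e using that by blast
    have "pair_row m u v \<bullet> h = 0"
    proof (cases "u = v")
      case False
      then show ?thesis using orth[of "{u, v}"] by (simp add: edge_row_pair C_def)
    qed simp
    then show ?thesis using len[of u v] by simp
  qed
  then show ?thesis unfolding rigid_framework_def using \<epsilon>(1) by blast
qed

text \<open>An affine dependence \<open>\<lambda>\<close> of \<open>d + 2\<close> points gives the equilibrium stress \<open>\<lambda> i * \<lambda> j\<close> on the pairs \<open>ij\<close>.\<close>

lemma pair_row_glue:
  fixes p :: "'v::finite \<Rightarrow> real^'d"
  assumes p: "generic_placement p" and C: "card C = CARD('d)" "a \<notin> C" "b \<notin> C" "a \<noteq> b"
    and S: "subspace S"
    and SA: "\<And>u v. u \<in> insert a C \<Longrightarrow> v \<in> insert a C \<Longrightarrow> pair_row p u v \<in> S"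
    and SB: "\<And>u v. u \<in> insert b C \<Longrightarrow> v \<in> insert b C \<Longrightarrow> pair_row p u v \<in> S"
  shows "pair_row p a b \<in> S"
proof -
  let ?f = "\<lambda>u. p a - p u"
  have ind: "indep_family C ?f" using indep_family_generic_differences[OF p] C by simp
  note ii = indep_family_imp_inj_independent[OF _ ind]
  have "UNIV \<subseteq> span (?f ` C)"
    using ii C by (intro card_ge_dim_independent) (auto simp: card_image)
  then have "p a - p b \<in> span (?f ` C)" by blast
  then obtain g where "p a - p b = (\<Sum>x\<in>?f ` C. g x *\<^sub>R x)"
    by (auto simp: span_finite)
  then have g: "p a - p b = (\<Sum>u\<in>C. g (?f u) *\<^sub>R ?f u)"
    using ii(1) by (simp add: sum.reindex)
  define \<mu> where "\<mu> u = g (?f u)" for u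
  \<comment> \<open>The coefficients of the affine dependence: -1 at \<open>b\<close>,
    \<open>\<mu>\<close> on \<open>C\<close>, and at \<open>a\<close> whatever makes the sum
    zero.\<close>
  define l where "l i = (if i = a then 1 - (\<Sum>u\<in>C. \<mu> u) else if i = b then -1 else \<mu> i)" for i
  define P where "P = insert a (insert b C)"
  have lC: "l i = \<mu> i" if "i \<in> C" for i using that C by (auto simp: l_def)
  have sumP: "(\<Sum>i\<in>P. F i) = F a + F b + (\<Sum>i\<in>C. F i)" for F :: "'v \<Rightarrow> 'b::ab_group_add"
    unfolding P_def using C by (simp add: add.assoc)
  \<comment> \<open>Otherwise \<open>b\<close> and \<open>C\<close> would be \<open>d + 1\<close>
    affinely dependent points.\<close>
  have la: "l a \<noteq> 0"
  proof
    assume "l a = 0"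
    then have s: "(\<Sum>u\<in>C. \<mu> u) = 1" by (simp add: l_def)
    have "(\<Sum>u\<in>C. \<mu> u *\<^sub>R (p b - p u)) = (\<Sum>u\<in>C. \<mu> u *\<^sub>R (p a - p u)) - (\<Sum>u\<in>C. \<mu> u) *\<^sub>R (p a - p b)"
      by (simp add: scaleR_sum_left sum_subtractf[symmetric] algebra_simps)
    also have "\<dots> = 0" using g s by (simp add: \<mu>_def)
    finally have "\<mu> u = 0" if "u \<in> C" for u
      using indep_familyD[OF indep_family_generic_differences[OF p, of C b], of \<mu> u] that C by simp
    then show False using s by simp
  qed
  have "(\<Sum>j\<in>P. l j) = 0"
    unfolding sumP using C lC by (simp add: l_def)
  moreover have "(\<Sum>j\<in>P. l j *\<^sub>R p j) = 0"
  proof -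
    have "(\<Sum>j\<in>P. l j *\<^sub>R p j) = (1 - (\<Sum>u\<in>C. \<mu> u)) *\<^sub>R p a - p b + (\<Sum>u\<in>C. \<mu> u *\<^sub>R p u)"
      unfolding sumP using C lC by (simp add: l_def)
    also have "\<dots> = p a - p b - (\<Sum>u\<in>C. \<mu> u *\<^sub>R ?f u)"
      by (simp add: scaleR_left_diff_distrib scaleR_right_diff_distrib sum_subtractf scaleR_sum_left)
    finally show ?thesis using g by (simp add: \<mu>_def)
  qed
  ultimately have bal: "(\<Sum>j\<in>P. l j *\<^sub>R (p i - p j)) = 0" for i
    by (simp add: scaleR_right_diff_distrib sum_subtractf scaleR_sum_left[symmetric])
  define X where "X i j = (l i * l j) *\<^sub>R pair_row p i j" for i j
  \<comment> \<open>Equilibrium at each vertex \<open>i\<close>, obtained by multiplying the affine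
    dependence by \<open>l i\<close>.\<close>
  have half: "(\<Sum>i\<in>P. \<Sum>j\<in>P. (l i * l j) *\<^sub>R at_vertex i (p i - p j)) = 0"
  proof (rule sum.neutral, rule ballI)
    fix i
    have "(\<Sum>j\<in>P. (l i * l j) *\<^sub>R at_vertex i (p i - p j)) = at_vertex i (l i *\<^sub>R (\<Sum>j\<in>P. l j *\<^sub>R (p i - p j)))"
      by (simp add: linear_sum[OF linear_at_vertex] linear_scale[OF linear_at_vertex] scaleR_sum_right)
    then show "(\<Sum>j\<in>P. (l i * l j) *\<^sub>R at_vertex i (p i - p j)) = 0"
      by (simp add: bal linear_0[OF linear_at_vertex])
  qed
  have "(\<Sum>i\<in>P. \<Sum>j\<in>P. X i j) = (\<Sum>i\<in>P. \<Sum>j\<in>P. (l i * l j) *\<^sub>R at_vertex i (p i - p j))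
      + (\<Sum>i\<in>P. \<Sum>j\<in>P. (l i * l j) *\<^sub>R at_vertex j (p j - p i))"
    unfolding X_def pair_row_def scaleR_add_right sum.distrib ..
  also have "(\<Sum>i\<in>P. \<Sum>j\<in>P. (l i * l j) *\<^sub>R at_vertex j (p j - p i))
      = (\<Sum>i\<in>P. \<Sum>j\<in>P. (l i * l j) *\<^sub>R at_vertex i (p i - p j))"
    by (rule trans[OF sum.swap]) (simp add: mult.commute)
  finally have "(\<Sum>i\<in>P. \<Sum>j\<in>P. X i j) = 0" using half by simp
  \<comment> \<open>Every pair in \<open>P\<close> other than \<open>ab\<close> lies in
    \<open>insert a C\<close> or in \<open>insert b C\<close>, so the vanishing total stress
    expresses the row of \<open>ab\<close> by rows in \<open>S\<close>.\<close>
  then have eq: "X a b + X b a = - (X a a + (\<Sum>j\<in>C. X a j) + X b b + (\<Sum>j\<in>C. X b j)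
      + ((\<Sum>i\<in>C. X i a) + (\<Sum>i\<in>C. X i b) + (\<Sum>i\<in>C. \<Sum>j\<in>C. X i j)))" (is "_ = - ?R")
    unfolding sumP sum.distrib by (simp add: algebra_simps eq_neg_iff_add_eq_0)
  have XA: "X i j \<in> S" if "i \<in> insert a C" "j \<in> insert a C" for i j
    unfolding X_def using SA[OF that] S by (simp add: subspace_scale)
  have XB: "X i j \<in> S" if "i \<in> insert b C" "j \<in> insert b C" for i j
    unfolding X_def using SB[OF that] S by (simp add: subspace_scale)
  have "- ?R \<in> S"
    by (intro subspace_neg subspace_add subspace_sum S) (auto intro: XA XB)
  moreover have "X a b + X b a = (2 * l a * l b) *\<^sub>R pair_row p a b"
    by (simp add: X_def pair_row_commute[of p b a] scaleR_add_left[symmetric])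
  ultimately have "(2 * l a * l b) *\<^sub>R pair_row p a b \<in> S" using eq by metis
  moreover have "2 * l a * l b \<noteq> 0" using la C by (simp add: l_def)
  ultimately show ?thesis by (metis S subspace_scale scaleR_scaleR left_inverse scaleR_one)
qed

text \<open>A dependence involving the \<open>r t\<close> modulo the span of \<open>S\<close> would
  be mapped by \<open>f\<close> to a dependence of the images. Later \<open>f\<close> reads off the
  columns of a new vertex.\<close>

lemma dim_Un_image_ge:
  fixes f :: "'a::euclidean_space \<Rightarrow> 'b::euclidean_space"
  assumes f: "linear f" and S: "\<And>x. x \<in> S \<Longrightarrow> f x = 0"
    and T: "finite T" "indep_family T (\<lambda>t. f (r t))"
  shows "dim S + card T \<le> dim (S \<union> r ` T)"
  using T
proof (induction T rule: finite_induct)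
  case (insert t T)
  have IH: "dim S + card T \<le> dim (S \<union> r ` T)"
    using insert indep_family_mono[of "insert t T"] by auto
  have "r t \<notin> span (S \<union> r ` T)"
  proof
    assume "r t \<in> span (S \<union> r ` T)"
    then have "f (r t) \<in> span (f ` (S \<union> r ` T))"
      using linear_span_image[OF f] by blast
    moreover have "f ` (S \<union> r ` T) \<subseteq> insert 0 ((\<lambda>t. f (r t)) ` T)"
      using S by auto
    ultimately have "f (r t) \<in> span ((\<lambda>t. f (r t)) ` T)"
      using span_mono span_insert_0 by blast
    moreover have "f (r t) \<notin> (\<lambda>t. f (r t)) ` T" "independent (insert (f (r t)) ((\<lambda>t. f (r t)) ` T))"
      using indep_family_imp_inj_independent[OF _ insert.prems] insert.hyps by auto
    ultimately show False by (simp add: independent_insert)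
  qed
  then have "dim (S \<union> r ` insert t T) = dim (S \<union> r ` T) + 1"
    by (simp add: dim_insert)
  then show ?case using IH insert.hyps by simp
qed simp

section \<open>Random vertex orders\<close>

lemma sum_min_atMost:
  fixes c D :: nat
  assumes "c \<le> D"
  shows "(\<Sum>j\<le>D. real (min j c)) = real c * (real D + 1) - real c * (real c + 1) / 2"
  using assms
proof (induction D rule: dec_induct)
  case base
  have "(\<Sum>j\<le>c. real (min j c)) = (\<Sum>j\<le>c. real j)"
    by (intro sum.cong) auto
  also have "\<dots> = real c * (real c + 1) / 2"
    by (induction c) (auto simp: field_simps)
  finally show ?case by (simp add: field_simps)
next
  case (step n)
  then show ?case by (simp add: field_simps)
qed

lemma sum_real_greaterThanAtMost:
  fixes c D :: nat
  assumes "c \<le> D"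
  shows "(\<Sum>j\<le>D. if c < j then real j else 0) = (real D * (real D + 1) - real c * (real c + 1)) / 2"
  using assms
proof (induction D rule: dec_induct)
  case base
  have "(\<Sum>j\<le>c. if c < j then real j else 0) = 0"
    by (intro sum.neutral) auto
  then show ?case by simp
next
  case (step n)
  then show ?case by (simp add: field_simps)
qed

text \<open>The mean of \<open>g\<close> at the set of earlier neighbours of a vertex with neighbourhood \<open>N\<close> when the vertices
  are ordered uniformly at random.\<close>

definition subset_mean :: "('a set \<Rightarrow> real) \<Rightarrow> 'a set \<Rightarrow> real" where
  "subset_mean g N = (\<Sum>A\<in>Pow N. g A / real (card N choose card A)) / (real (card N) + 1)"

text \<open>Condition on the last element of the vertex together with \<open>N\<close>: if it is the
  vertex itself, all of \<open>N\<close> is earlier; if it is some \<open>u\<close> in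
  \<open>N\<close>, the order of the others is uniform. In the sum, a proper subset \<open>A\<close>
  occurs \<open>card N - card A\<close> times, which the binomial weights absorb.\<close>

lemma subset_mean_rec:
  assumes "finite N"
  shows "(real (card N) + 1) * subset_mean g N = g N + (\<Sum>u\<in>N. subset_mean g (N - {u}))"
proof -
  let ?D = "card N"
  have "(\<Sum>u\<in>N. subset_mean g (N - {u}))
      = (\<Sum>u\<in>N. \<Sum>A\<in>Pow N. if u \<in> A then 0 else g A / (real ?D * real ((?D - 1) choose card A)))"
  proof (rule sum.cong[OF refl])
    fix u assume u: "u \<in> N"
    have c: "card (N - {u}) = ?D - 1" "?D > 0" using u assms by (auto simp: card_gt_0_iff)
    have P: "Pow (N - {u}) = {A \<in> Pow N. u \<notin> A}" by auto
    have "subset_mean g (N - {u})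
        = (\<Sum>A\<in>{A \<in> Pow N. u \<notin> A}. g A / (real ?D * real ((?D - 1) choose card A)))"
      using c unfolding subset_mean_def P
      by (simp add: of_nat_diff sum_divide_distrib divide_simps mult.commute)
    also have "\<dots> = (\<Sum>A\<in>Pow N. if u \<notin> A then g A / (real ?D * real ((?D - 1) choose card A)) else 0)"
      using assms by (subst sum.inter_filter[symmetric]) auto
    finally show "subset_mean g (N - {u})
      = (\<Sum>A\<in>Pow N. if u \<in> A then 0 else g A / (real ?D * real ((?D - 1) choose card A)))"
      by (simp add: if_distrib cong: sum.cong) (smt (verit) sum.cong)
  qed
  also have "\<dots> = (\<Sum>A\<in>Pow N. \<Sum>u\<in>N. if u \<in> A then 0 else g A / (real ?D * real ((?D - 1) choose card A)))"
    by (rule sum.swap)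
  also have "\<dots> = (\<Sum>A\<in>Pow N. if A = N then 0 else g A / real (?D choose card A))"
  proof (rule sum.cong[OF refl])
    fix A assume A: "A \<in> Pow N"
    let ?t = "g A / (real ?D * real ((?D - 1) choose card A))"
    have fA: "finite A" using A assms finite_subset by auto
    have "(\<Sum>u\<in>N. if u \<in> A then 0 else ?t) = (\<Sum>u\<in>N - A. ?t)"
      using assms by (intro sum.mono_neutral_cong_right) auto
    also have "\<dots> = real (?D - card A) * ?t"
      using A fA by (simp add: card_Diff_subset)
    also have "\<dots> = (if A = N then 0 else g A / real (?D choose card A))"
    proof (cases "A = N")
      case False
      then have lt: "card A < ?D" using A assms by (meson PowD psubsetI psubset_card_mono)
      have e: "real (?D - card A) * real (?D choose card A) = real ?D * real ((?D - 1) choose card A)"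
        using binomial_absorb_comp[of ?D "card A"] by (metis of_nat_mult)
      have "(?D choose card A) > 0" using lt by simp
      then show ?thesis using lt False
        unfolding e[symmetric] by (simp add: divide_simps)
    qed simp
    finally show "(\<Sum>u\<in>N. if u \<in> A then 0 else ?t) = (if A = N then 0 else g A / real (?D choose card A))" .
  qed
  also have "\<dots> = (\<Sum>A\<in>Pow N - {N}. g A / real (?D choose card A))"
    using assms by (intro sum.mono_neutral_cong_right) auto
  finally have "g N + (\<Sum>u\<in>N. subset_mean g (N - {u})) = (\<Sum>A\<in>Pow N. g A / real (?D choose card A))"
    using assms by (simp add: sum.remove[of "Pow N" N])
  then show ?thesis unfolding subset_mean_def by simp
qed

text \<open>The size of the random subset is uniform on \<open>0, ..., card N\<close>, and given its
  size the subset is uniform; so bounds on the average for each size add up.\<close>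

lemma subset_mean_ge:
  assumes "finite N"
    and "\<And>j. j \<le> card N \<Longrightarrow> b j * real (card N choose j) \<le> (\<Sum>A\<in>{A. A \<subseteq> N \<and> card A = j}. g A)"
  shows "(\<Sum>j\<le>card N. b j) \<le> (real (card N) + 1) * subset_mean g N"
proof -
  let ?D = "card N"
  have "(real ?D + 1) * subset_mean g N = (\<Sum>A\<in>Pow N. g A / real (?D choose card A))"
    unfolding subset_mean_def by simp
  also have "\<dots> = (\<Sum>j\<in>{..?D}. \<Sum>A\<in>{A\<in>Pow N. card A = j}. g A / real (?D choose card A))"
    using assms(1) by (intro sum.group[symmetric]) (auto intro: card_mono)
  also have "\<dots> = (\<Sum>j\<le>?D. (\<Sum>A\<in>{A. A \<subseteq> N \<and> card A = j}. g A) / real (?D choose j))"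
    unfolding sum_divide_distrib by (intro sum.cong) auto
  also have "\<dots> \<ge> (\<Sum>j\<le>?D. b j)"
  proof (rule sum_mono)
    fix j assume "j \<in> {..?D}"
    then show "b j \<le> (\<Sum>A\<in>{A. A \<subseteq> N \<and> card A = j}. g A) / real (?D choose j)"
      using assms(2)[of j] by (subst pos_le_divide_eq) auto
  qed
  finally show ?thesis .
qed

section \<open>Cliques and random orders in a graph with clique gluing\<close>

text \<open>The combinatorial properties of the closure that the counting uses. Reflexivity spares
  the condition \<open>u \<noteq> v\<close> in statements about cliques.\<close>

locale glued_clique_graph =
  fixes adj :: "'v::finite \<Rightarrow> 'v \<Rightarrow> bool" and d :: nat
  assumes adj_sym: "adj u v \<Longrightarrow> adj v u"
    and adj_refl: "adj u u"
    and adj_glue: "\<lbrakk>\<forall>u\<in>A. \<forall>v\<in>A. adj u v; \<forall>u\<in>B. \<forall>v\<in>B. adj u v; d \<le> card (A \<inter> B); a \<in> A; b \<in> B\<rbrakk> \<Longrightarrow> adj a b"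
begin

definition clique :: "'v set \<Rightarrow> bool" where
  "clique A \<longleftrightarrow> (\<forall>u\<in>A. \<forall>v\<in>A. adj u v)"

definition nbrs :: "'v set \<Rightarrow> 'v \<Rightarrow> 'v set" where
  "nbrs W v = {u \<in> W. u \<noteq> v \<and> adj u v}"

text \<open>The rank increase guaranteed for a vertex with earlier neighbours \<open>A\<close>; the
  extra 1 is that of a 1-extension.\<close>

definition gain :: "'v set \<Rightarrow> nat" where
  "gain A = min (card A) d + (if d < card A \<and> \<not> clique A then 1 else 0)"

lemma clique_subset: "clique A \<Longrightarrow> B \<subseteq> A \<Longrightarrow> clique B"
  unfolding clique_def by blast

lemma clique_Un: "clique A \<Longrightarrow> clique B \<Longrightarrow> d \<le> card (A \<inter> B) \<Longrightarrow> clique (A \<union> B)"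
  unfolding clique_def using adj_glue[of A B] adj_sym by (metis Un_iff)

lemma clique_insert: "clique A \<Longrightarrow> (\<forall>u\<in>A. adj u v) \<Longrightarrow> clique (insert v A)"
  unfolding clique_def using adj_refl adj_sym by blast

text \<open>Adding the centre \<open>v\<close> to both cliques saves one common vertex.\<close>

lemma clique_Un_nbrs:
  assumes "A \<subseteq> nbrs W v" "B \<subseteq> nbrs W v" "clique A" "clique B" "d \<le> card (A \<inter> B) + 1"
  shows "clique (A \<union> B)"
proof -
  have "v \<notin> A \<inter> B" using assms(1) by (auto simp: nbrs_def)
  then have "card (insert v A \<inter> insert v B) = card (A \<inter> B) + 1"
    by simp
  moreover have "clique (insert v A)" "clique (insert v B)"
    using assms by (auto intro!: clique_insert simp: nbrs_def)
  ultimately have "clique (insert v A \<union> insert v B)"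
    using assms(5) by (intro clique_Un) auto
  then show ?thesis by (rule clique_subset) auto
qed

text \<open>Double counting of the pairs \<open>(A, B)\<close> of a clique \<open>A\<close> and a non-clique \<open>B\<close> arising from \<open>A\<close> by exchanging
  one vertex: a clique has at least \<open>j\<close> partners, a non-clique at most \<open>D - j\<close>.\<close>

lemma card_noncliques_ge:
  assumes nc: "\<not> clique (nbrs W v)" and j: "d < j"
  shows "j * (card (nbrs W v) choose j)
    \<le> card (nbrs W v) * card {A. A \<subseteq> nbrs W v \<and> card A = j \<and> \<not> clique A}"
proof (cases "j \<le> card (nbrs W v)")
  case False
  then have "(card (nbrs W v) choose j) = 0" by (intro binomial_eq_0) simp
  then show ?thesis by (metis le0 mult_0_right)
next
  case jD: True
  define N where "N = nbrs W v"
  define Q where "Q = {A. A \<subseteq> N \<and> card A = j \<and> clique A}"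
  define R where "R = {A. A \<subseteq> N \<and> card A = j \<and> \<not> clique A}"
  define rel where "rel = (\<lambda>A B. \<exists>q\<in>A. \<exists>x\<in>N - A. B = insert x (A - {q}))"
  have un: "clique (A \<union> B)" if "A \<subseteq> N" "B \<subseteq> N" "clique A" "clique B" "d \<le> card (A \<inter> B) + 1" for A B
    using clique_Un_nbrs[of A W v B] that unfolding N_def by blast
  have lower: "j \<le> card {B \<in> R. rel A B}" if A: "A \<in> Q" for A
  proof -
    have AN: "A \<subseteq> N" "card A = j" "clique A" using A unfolding Q_def by auto
    \<comment> \<open>\<open>M\<close> is a maximal clique of \<open>N\<close> above
      \<open>A\<close>. It omits some \<open>x\<close> because \<open>N\<close> is not a clique, and
      exchanging any \<open>q\<close> in \<open>A\<close> for this \<open>x\<close> gives the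
      \<open>j\<close> partners.\<close>
    define F where "F = {M. A \<subseteq> M \<and> M \<subseteq> N \<and> clique M}"
    have "A \<in> F" unfolding F_def using AN by simp
    then obtain M where MF: "M \<in> F" and max: "\<And>M'. M' \<in> F \<Longrightarrow> M \<subseteq> M' \<Longrightarrow> M = M'"
      using finite_has_maximal2[of F A] by auto
    have M: "A \<subseteq> M" "M \<subseteq> N" "clique M" using MF unfolding F_def by auto
    have "M \<noteq> N" using M nc N_def by auto
    then obtain x where x: "x \<in> N" "x \<notin> M" using M by blast
    have "inj_on (\<lambda>q. insert x (A - {q})) A"
      using x M by (auto simp: inj_on_def)
    moreover have "(\<lambda>q. insert x (A - {q})) ` A \<subseteq> {B \<in> R. rel A B}"
    proof safe
      fix q assume q: "q \<in> A"
      have xA: "x \<notin> A" using x M by auto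
      have cAq: "card (A - {q}) = j - 1" using q AN by simp
      show "rel A (insert x (A - {q}))" unfolding rel_def using q x xA by auto
      \<comment> \<open>A clique would share the \<open>j - 1\<close> vertices of
        \<open>A - {q}\<close> with \<open>M\<close>, and gluing would enlarge \<open>M\<close> by
        \<open>x\<close>.\<close>
      have "\<not> clique (insert x (A - {q}))"
      proof
        assume c: "clique (insert x (A - {q}))"
        have "card (A - {q}) \<le> card (M \<inter> insert x (A - {q}))"
          using M by (intro card_mono) auto
        then have "clique (M \<union> insert x (A - {q}))"
          using c M AN x j cAq by (intro un) auto
        then have "M = M \<union> insert x (A - {q})"
          using M AN x unfolding F_def by (intro max[unfolded F_def]) auto
        then show False using x by auto
      qed
      then show "insert x (A - {q}) \<in> R"
        unfolding R_def using AN x xA cAq j by (simp add: subset_iff)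
    qed
    ultimately have "card A \<le> card {B \<in> R. rel A B}"
      by (rule card_inj_on_le) simp
    then show ?thesis using AN by simp
  qed
  have upper: "card {A \<in> Q. rel A B} \<le> card N - j" if B: "B \<in> R" for B
  proof (cases "{A \<in> Q. rel A B} = {}")
    case True
    then show ?thesis by (metis card.empty le0)
  next
    case False
    have BN: "B \<subseteq> N" "card B = j" "\<not> clique B" using B unfolding R_def by auto
    have rel_swap: "\<exists>x\<in>B. \<exists>q\<in>N - B. A = insert q (B - {x}) \<and> clique (B - {x})"
      if A: "A \<in> Q" "rel A B" for A
    proof -
      obtain q x where qx: "q \<in> A" "x \<in> N - A" "B = insert x (A - {q})"
        using A(2) unfolding rel_def by blast
      have AN: "A \<subseteq> N" "clique A" using A(1) unfolding Q_def by auto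
      have "A = insert q (B - {x})" "q \<in> N - B" using qx AN by auto
      moreover have "clique (B - {x})" using AN qx by (elim clique_subset) auto
      ultimately show ?thesis using qx(3) by blast
    qed
    obtain r where r: "r \<in> B" "clique (B - {r})" using False rel_swap by blast
    \<comment> \<open>Two different removable vertices would leave cliques sharing
      \<open>j - 2\<close> vertices. As \<open>j > d\<close>, this is just enough for gluing at the
      centre \<open>v\<close>, and \<open>B\<close> would be a clique.\<close>
    have uniq: "x = r" if x: "x \<in> B" "clique (B - {x})" for x
    proof (rule ccontr)
      assume ne: "x \<noteq> r"
      have "(B - {x}) \<inter> (B - {r}) = B - {x, r}" by auto
      then have "card ((B - {x}) \<inter> (B - {r})) = j - 2"
        using x r ne BN by (simp add: card_Diff_subset)
      then have "clique ((B - {x}) \<union> (B - {r}))"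
        using x r j BN by (intro un) auto
      moreover have "(B - {x}) \<union> (B - {r}) = B" using ne by auto
      ultimately show False using BN by simp
    qed
    have "{A \<in> Q. rel A B} \<subseteq> (\<lambda>q. insert q (B - {r})) ` (N - B)"
      using rel_swap uniq by blast
    then have "card {A \<in> Q. rel A B} \<le> card (N - B)"
      by (meson card_image_le card_mono finite finite_imageI le_trans)
    then show ?thesis using BN by (simp add: card_Diff_subset)
  qed
  have "j * card Q \<le> (\<Sum>A\<in>Q. card {B \<in> R. rel A B})"
    using sum_bounded_below[of Q j "\<lambda>A. card {B \<in> R. rel A B}"] lower by (simp add: mult.commute)
  also have "\<dots> = (\<Sum>B\<in>R. card {A \<in> Q. rel A B})"
    by (rule sum_multicount_gen) auto
  also have "\<dots> \<le> card R * (card N - j)"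
    using sum_bounded_above[of R "\<lambda>B. card {A \<in> Q. rel A B}" "card N - j"] upper by simp
  finally have 1: "j * card Q \<le> card R * (card N - j)" .
  have "{A. A \<subseteq> N \<and> card A = j} = Q \<union> R" "Q \<inter> R = {}"
    unfolding Q_def R_def by auto
  then have 2: "(card N choose j) = card Q + card R"
    using n_subsets[of N j] by (simp add: card_Un_disjoint)
  have "j * (card N choose j) = j * card Q + j * card R"
    unfolding 2 by (simp add: algebra_simps)
  also have "\<dots> \<le> card R * (card N - j) + j * card R" using 1 by simp
  also have "\<dots> = card N * card R"
    using jD unfolding N_def[symmetric] by (metis add_mult_distrib2 le_add_diff_inverse2 mult.commute)
  finally show ?thesis unfolding N_def R_def .
qed

text \<open>Since \<open>k \<le> d\<close>, the gain is at least \<open>min j k\<close> for sets of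
  size \<open>j\<close>. Its mean over uniform \<open>j\<close> is
  \<open>k - k (k + 1) / (2 (D + 1))\<close> with \<open>D = card N\<close>, and
  \<open>k \<le> D\<close>.\<close>

lemma subset_mean_gain_ge_half:
  assumes "k \<le> d" "k \<le> card N"
  shows "real k / 2 \<le> subset_mean (\<lambda>A. real (gain A)) N"
proof -
  let ?D = "card N"
  have "(\<Sum>j\<le>?D. real (min j k)) \<le> (real ?D + 1) * subset_mean (\<lambda>A. real (gain A)) N"
  proof (rule subset_mean_ge)
    fix j assume "j \<le> ?D"
    have "real (min j k) * real (?D choose j) = (\<Sum>A\<in>{A. A \<subseteq> N \<and> card A = j}. real (min j k))"
      by (simp add: n_subsets)
    also have "\<dots> \<le> (\<Sum>A\<in>{A. A \<subseteq> N \<and> card A = j}. real (gain A))"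
      using assms by (intro sum_mono) (auto simp: gain_def)
    finally show "real (min j k) * real (?D choose j) \<le> (\<Sum>A\<in>{A. A \<subseteq> N \<and> card A = j}. real (gain A))" .
  qed simp
  then have "real k * (real ?D + 1) - real k * (real k + 1) / 2 \<le> (real ?D + 1) * subset_mean (\<lambda>A. real (gain A)) N"
    using sum_min_atMost[OF assms(2)] by simp
  moreover have "real k * (real k + 1) / 2 \<le> real k * (real ?D + 1) / 2"
    using assms by (simp add: mult_left_mono)
  ultimately have "(real k / 2) * (real ?D + 1) \<le> subset_mean (\<lambda>A. real (gain A)) N * (real ?D + 1)"
    by (simp add: mult.commute[of _ "real ?D + 1"] field_simps)
  then show ?thesis by (rule mult_right_le_imp_le) simp
qed

text \<open>For size \<open>j\<close> the mean gain is at least \<open>min j d\<close>, plus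
  \<open>j / D\<close> when \<open>j > d\<close> by the count of non-cliques; the sum over
  \<open>j\<close> is exactly \<open>D + 1\<close> times the bound.\<close>

lemma subset_mean_gain_ge:
  assumes nc: "\<not> clique (nbrs W v)" and D: "d < card (nbrs W v)"
  defines "D \<equiv> real (card (nbrs W v))"
  shows "real d + 1 / 2 - real d * (real d + 1) / (2 * D)
    \<le> subset_mean (\<lambda>A. real (gain A)) (nbrs W v)"
proof -
  let ?N = "nbrs W v"
  have Dpos: "D > 0" using D D_def by simp
  have "(\<Sum>j\<le>card ?N. real (min j d) + (if d < j then real j else 0) / D)
      \<le> (D + 1) * subset_mean (\<lambda>A. real (gain A)) ?N"
    unfolding D_def
  proof (rule subset_mean_ge)
    fix j assume "j \<le> card ?N"
    let ?S = "{A. A \<subseteq> ?N \<and> card A = j}"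
    have "(if d < j then real j else 0) / D * real (card ?N choose j)
        \<le> (\<Sum>A\<in>?S. if d < card A \<and> \<not> clique A then 1 else 0)"
    proof (cases "d < j")
      case True
      have e: "(\<Sum>A\<in>?S. if d < card A \<and> \<not> clique A then 1 else 0 :: real)
          = (\<Sum>A\<in>{A \<in> ?S. \<not> clique A}. 1)"
        using True by (intro sum.mono_neutral_cong_right) auto
      have "real j * real (card ?N choose j) \<le> D * real (card {A. A \<subseteq> ?N \<and> card A = j \<and> \<not> clique A})"
        using card_noncliques_ge[OF nc True] unfolding D_def of_nat_mult[symmetric] of_nat_le_iff .
      then have "real j / D * real (card ?N choose j)
          \<le> real (card {A. A \<subseteq> ?N \<and> card A = j \<and> \<not> clique A})"
        using Dpos by (simp add: divide_simps mult.commute)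
      then show ?thesis using True unfolding e by (simp add: conj_assoc)
    qed (simp add: sum_nonneg)
    moreover have "real (min j d) * real (card ?N choose j) = (\<Sum>A\<in>?S. real (min (card A) d))"
      by (simp add: n_subsets)
    ultimately have "(real (min j d) + (if d < j then real j else 0) / D) * real (card ?N choose j)
      \<le> (\<Sum>A\<in>?S. real (min (card A) d) + (if d < card A \<and> \<not> clique A then 1 else 0))"
      unfolding sum.distrib distrib_right by linarith
    also have "\<dots> = (\<Sum>A\<in>?S. real (gain A))"
      by (intro sum.cong) (auto simp: gain_def)
    finally show "(real (min j d) + (if d < j then real j else 0) / real (card ?N)) * real (card ?N choose j)
      \<le> (\<Sum>A\<in>?S. real (gain A))" unfolding D_def .
  qed simp
  also have "(\<Sum>j\<le>card ?N. real (min j d) + (if d < j then real j else 0) / D)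
     = (real d * (D + 1) - real d * (real d + 1) / 2) + (D * (D + 1) - real d * (real d + 1)) / 2 / D"
    using D unfolding sum.distrib sum_divide_distrib[symmetric] D_def
    by (simp add: sum_min_atMost sum_real_greaterThanAtMost)
  also have "\<dots> = (D + 1) * (real d + 1 / 2 - real d * (real d + 1) / (2 * D))"
    using Dpos by (simp add: field_simps)
  finally show ?thesis
    using Dpos by simp
qed

text \<open>Instead of averaging over orders, average over the choice of the last vertex and recurse.\<close>

lemma rank_ge_sum_subset_mean:
  fixes \<rho> :: "'v set \<Rightarrow> nat"
  assumes ext: "\<And>W v. v \<notin> W \<Longrightarrow> \<rho> W + gain (nbrs W v) \<le> \<rho> (insert v W)"
  shows "(\<Sum>v\<in>W. subset_mean (\<lambda>A. real (gain A)) (nbrs W v)) \<le> real (\<rho> W)"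
  using finite[of W]
proof (induction W rule: finite_psubset_induct)
  case (psubset W)
  let ?h = "subset_mean (\<lambda>A. real (gain A))"
  show ?case
  proof (cases "W = {}")
    case False
    then have cW: "card W > 0" by (simp add: card_gt_0_iff)
    have "real (gain (nbrs W v)) + (\<Sum>u\<in>W - {v}. ?h (nbrs (W - {v}) u)) \<le> real (\<rho> W)" if "v \<in> W" for v
    proof -
      have "nbrs (W - {v}) v = nbrs W v" unfolding nbrs_def by auto
      then have "\<rho> (W - {v}) + gain (nbrs W v) \<le> \<rho> W"
        using ext[of v "W - {v}"] that by (simp add: insert_absorb)
      moreover have "(\<Sum>u\<in>W - {v}. ?h (nbrs (W - {v}) u)) \<le> real (\<rho> (W - {v}))"
        using that by (intro psubset.IH) auto
      ultimately show ?thesis by linarith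
    qed
    then have "(\<Sum>v\<in>W. real (gain (nbrs W v)) + (\<Sum>u\<in>W - {v}. ?h (nbrs (W - {v}) u)))
        \<le> real (card W) * real (\<rho> W)"
      by (rule sum_bounded_above)
    \<comment> \<open>For fixed \<open>u\<close>, deleting a non-neighbour leaves the neighbourhood
      unchanged, and the deletions of neighbours are summed by \<open>subset_mean_rec\<close>. The
      gains subtracted here cancel those of the last vertices.\<close>
    moreover have "(\<Sum>v\<in>W. \<Sum>u\<in>W - {v}. ?h (nbrs (W - {v}) u))
        = (\<Sum>u\<in>W. (real (card W) * ?h (nbrs W u) - real (gain (nbrs W u))))"
    proof -
      have "(\<Sum>v\<in>W. \<Sum>u\<in>W - {v}. ?h (nbrs (W - {v}) u))
          = (\<Sum>v\<in>W. \<Sum>u\<in>W. if u = v then 0 else ?h (nbrs (W - {v}) u))"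
        by (intro sum.cong refl sum.mono_neutral_cong_left) auto
      also have "\<dots> = (\<Sum>u\<in>W. \<Sum>v\<in>W. if u = v then 0 else ?h (nbrs (W - {v}) u))"
        by (rule sum.swap)
      also have "\<dots> = (\<Sum>u\<in>W. (real (card W) * ?h (nbrs W u) - real (gain (nbrs W u))))"
      proof (rule sum.cong[OF refl])
        fix u assume u: "u \<in> W"
        let ?N = "nbrs W u"
        have NW: "?N \<subseteq> W - {u}" by (auto simp: nbrs_def)
        have cN: "card ?N \<le> card W - 1" using card_mono[OF _ NW] u by simp
        have "(\<Sum>v\<in>W. if u = v then 0 else ?h (nbrs (W - {v}) u)) = (\<Sum>v\<in>W - {u}. ?h (?N - {v}))"
        proof (rule sum.mono_neutral_cong_right)
          fix v assume "v \<in> W - {u}"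
          moreover have "nbrs (W - {v}) u = ?N - {v}" by (auto simp: nbrs_def)
          ultimately show "(if u = v then 0 else ?h (nbrs (W - {v}) u)) = ?h (?N - {v})" by auto
        qed auto
        also have "\<dots> = (\<Sum>v\<in>?N. ?h (?N - {v})) + (\<Sum>v\<in>W - {u} - ?N. ?h (?N - {v}))"
          using NW by (metis add.commute finite sum.subset_diff)
        also have "(\<Sum>v\<in>W - {u} - ?N. ?h (?N - {v})) = (\<Sum>v\<in>W - {u} - ?N. ?h ?N)"
          by (intro sum.cong) auto
        also have "\<dots> = real (card W - 1 - card ?N) * ?h ?N"
          using NW u by (simp add: card_Diff_subset)
        also have "real (card W - 1 - card ?N) = real (card W) - 1 - real (card ?N)"
          using cN cW by (simp add: of_nat_diff)
        also have "(\<Sum>v\<in>?N. ?h (?N - {v})) = (real (card ?N) + 1) * ?h ?N - real (gain ?N)"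
          using subset_mean_rec[of ?N "\<lambda>A. real (gain A)"] by simp
        finally show "(\<Sum>v\<in>W. if u = v then 0 else ?h (nbrs (W - {v}) u))
            = real (card W) * ?h ?N - real (gain ?N)"
          by (simp add: algebra_simps)
      qed
      finally show ?thesis .
    qed
    ultimately have "real (card W) * (\<Sum>u\<in>W. ?h (nbrs W u)) \<le> real (card W) * real (\<rho> W)"
      by (simp add: sum.distrib sum_subtractf sum_distrib_left)
    then show ?thesis using cW by simp
  qed simp
qed

text \<open>\<open>k\<close>-connectivity of the subgraph induced on \<open>W\<close>, stated without paths.\<close>

definition cut_connected :: "nat \<Rightarrow> 'v set \<Rightarrow> bool" where
  "cut_connected k W \<longleftrightarrow> k < card W \<and>
     (\<forall>A B. A \<noteq> {} \<longrightarrow> B \<noteq> {} \<longrightarrow> A \<union> B \<subseteq> W \<longrightarrow> (\<forall>a\<in>A. \<forall>b\<in>B. \<not> adj a b) \<longrightarrow> k \<le> card (W - (A \<union> B)))"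

lemma cut_connectedD:
  "\<lbrakk>cut_connected k W; A \<noteq> {}; B \<noteq> {}; A \<union> B \<subseteq> W; \<forall>a\<in>A. \<forall>b\<in>B. \<not> adj a b\<rbrakk>
    \<Longrightarrow> k \<le> card (W - (A \<union> B))"
  unfolding cut_connected_def by simp

text \<open>The neighbours of \<open>v\<close> separate it from the remaining vertices; if none
  remain, the size of \<open>W\<close> decides.\<close>

lemma cut_connected_card_nbrs:
  assumes "cut_connected k W" "v \<in> W"
  shows "k \<le> card (nbrs W v)"
proof (cases "W - {v} - nbrs W v = {}")
  case True
  then have "nbrs W v = W - {v}" by (auto simp: nbrs_def)
  moreover have "k < card W" using assms by (simp add: cut_connected_def)
  ultimately show ?thesis using assms by simp
next
  case False
  let ?B = "W - {v} - nbrs W v"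
  have "\<forall>a\<in>{v}. \<forall>b\<in>?B. \<not> adj a b" using adj_sym by (auto simp: nbrs_def)
  then have "k \<le> card (W - ({v} \<union> ?B))"
    using assms False by (intro cut_connectedD) auto
  also have "W - ({v} \<union> ?B) = nbrs W v" by (auto simp: nbrs_def)
  finally show ?thesis .
qed

text \<open>A clique cannot meet both sides of a separation, so \<open>v\<close> may join the side
  that its neighbours do not avoid, giving a separation of \<open>W\<close> with the same separator.
  Non-cliqueness of \<open>W - {v}\<close> makes the neighbourhood a proper subset, which keeps more
  than \<open>k\<close> vertices.\<close>

lemma cut_connected_remove:
  assumes W: "cut_connected k W" and v: "v \<in> W" and cl: "clique (nbrs W v)"
    and nc: "\<not> clique (W - {v})"
  shows "cut_connected k (W - {v})"
proof -
  have "nbrs W v \<noteq> W - {v}" using cl nc by metis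
  moreover have "nbrs W v \<subseteq> W - {v}" by (auto simp: nbrs_def)
  ultimately have "nbrs W v \<subset> W - {v}" by (rule psubsetI[rotated])
  then have "card (nbrs W v) < card (W - {v})" by (simp add: psubset_card_mono)
  then have "k < card (W - {v})" using cut_connected_card_nbrs[OF W v] by simp
  moreover have "k \<le> card (W - {v} - (A \<union> B))"
    if AB: "A \<noteq> {}" "B \<noteq> {}" "A \<union> B \<subseteq> W - {v}" "\<forall>a\<in>A. \<forall>b\<in>B. \<not> adj a b" for A B
  proof -
    have *: "k \<le> card (W - {v} - (A \<union> B))"
      if "A \<noteq> {}" "B \<noteq> {}" "A \<union> B \<subseteq> W - {v}" "\<forall>a\<in>A. \<forall>b\<in>B. \<not> adj a b" "nbrs W v \<inter> B = {}" for A B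
    proof -
      have "\<forall>a\<in>insert v A. \<forall>b\<in>B. \<not> adj a b"
        using that adj_sym unfolding nbrs_def by auto
      then have "k \<le> card (W - (insert v A \<union> B))"
        using W v that by (intro cut_connectedD) auto
      also have "W - (insert v A \<union> B) = W - {v} - (A \<union> B)" by auto
      finally show ?thesis .
    qed
    have "nbrs W v \<inter> B = {} \<or> nbrs W v \<inter> A = {}"
      using cl AB unfolding clique_def by blast
    then show ?thesis
      using *[of A B] *[of B A] AB adj_sym by (metis Un_commute)
  qed
  ultimately show ?thesis unfolding cut_connected_def by simp
qed

lemma rank_ge_rank_density:
  fixes \<rho> :: "'v set \<Rightarrow> nat"
  assumes ext: "\<And>W v. v \<notin> W \<Longrightarrow> \<rho> W + gain (nbrs W v) \<le> \<rho> (insert v W)"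
    and k: "k < d * (d + 1)"
    and W: "cut_connected k W" and nc: "\<not> clique W"
  shows "rank_density d k * real (card W) \<le> real (\<rho> W)"
proof (cases "k \<le> d")
  case True
  have "rank_density d k * real (card W) = (\<Sum>v\<in>W. real k / 2)"
    using True by (simp add: rank_density_def)
  also have "\<dots> \<le> (\<Sum>v\<in>W. subset_mean (\<lambda>A. real (gain A)) (nbrs W v))"
    using True cut_connected_card_nbrs[OF W] by (intro sum_mono subset_mean_gain_ge_half) auto
  also have "\<dots> \<le> real (\<rho> W)" by (rule rank_ge_sum_subset_mean[OF ext])
  finally show ?thesis .
next
  case False
  then have m: "rank_density d k = real d + 1 / 2 - real d * (real d + 1) / (2 * real k)" and kd: "d < k"
    by (auto simp: rank_density_def field_simps)
  \<comment> \<open>The bound \<open>k < d * (d + 1)\<close> enters here; it lets a vertex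
    contributing only \<open>d\<close> pay its share.\<close>
  have m_le: "rank_density d k \<le> real d"
  proof -
    have "real k < real d * (real d + 1)" using of_nat_mono[of "k + 1" "d * (d + 1)", where 'a = real] k by (simp add: algebra_simps)
    then show ?thesis using kd unfolding m by (simp add: field_simps)
  qed
  show ?thesis
    using finite[of W] W nc
  proof (induction W rule: finite_psubset_induct)
    case (psubset W)
    note deg = cut_connected_card_nbrs[OF psubset.prems(1)]
    show ?case
    proof (cases "\<exists>v\<in>W. clique (nbrs W v)")
      case True
      then obtain v where v: "v \<in> W" "clique (nbrs W v)" by blast
      \<comment> \<open>Otherwise \<open>W - {v}\<close> and \<open>v\<close> with its neighbours
        would be cliques with at least \<open>k > d\<close> common vertices, and gluing would make
        \<open>W\<close> a clique.\<close>
      have nc: "\<not> clique (W - {v})"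
      proof
        assume c: "clique (W - {v})"
        have i: "(W - {v}) \<inter> insert v (nbrs W v) = nbrs W v" by (auto simp: nbrs_def)
        have "clique (insert v (nbrs W v))"
          using v by (intro clique_insert) (auto simp: nbrs_def)
        then have "clique ((W - {v}) \<union> insert v (nbrs W v))"
          using c deg[OF v(1)] kd i by (intro clique_Un) simp_all
        then have "clique W" using v(1) by (elim clique_subset) auto
        then show False using psubset.prems(2) by blast
      qed
      have "rank_density d k * real (card (W - {v})) \<le> real (\<rho> (W - {v}))"
        using v nc cut_connected_remove[OF psubset.prems(1) v nc] by (intro psubset.IH) auto
      moreover have "nbrs (W - {v}) v = nbrs W v" by (auto simp: nbrs_def)
      then have "\<rho> (W - {v}) + d \<le> \<rho> W"
        using ext[of v "W - {v}"] v deg[OF v(1)] kd by (simp add: insert_absorb gain_def)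
      moreover have "real (card W) = real (card (W - {v})) + 1"
        using v(1) by (metis Suc_eq_plus1 card_Suc_Diff1 finite of_nat_1 of_nat_add)
      ultimately show ?thesis using m_le by (simp add: distrib_left)
    next
      case False
      have "rank_density d k * real (card W) = (\<Sum>v\<in>W. rank_density d k)" by simp
      also have "\<dots> \<le> (\<Sum>v\<in>W. subset_mean (\<lambda>A. real (gain A)) (nbrs W v))"
      proof (rule sum_mono)
        fix v assume v: "v \<in> W"
        have "real d * (real d + 1) / (2 * real (card (nbrs W v))) \<le> real d * (real d + 1) / (2 * real k)"
          using deg[OF v] kd by (intro divide_left_mono) auto
        then show "rank_density d k \<le> subset_mean (\<lambda>A. real (gain A)) (nbrs W v)"
          using subset_mean_gain_ge[of W v] False v deg[OF v] kd unfolding m by force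
      qed
      also have "\<dots> \<le> real (\<rho> W)" by (rule rank_ge_sum_subset_mean[OF ext])
      finally show ?thesis .
    qed
  qed
qed

end

section \<open>Extensions of the closure\<close>

text \<open>Adjacency in the closure of \<open>E\<close> in the rigidity matroid at
  \<open>p\<close>; using \<open>pair_row\<close> makes it reflexive.\<close>

definition linked :: "'v::finite set set \<Rightarrow> ('v \<Rightarrow> real^'d) \<Rightarrow> 'v \<Rightarrow> 'v \<Rightarrow> bool" where
  "linked E p u v \<longleftrightarrow> pair_row p u v \<in> span (edge_row p ` E)"

definition linked_edges :: "'v::finite set set \<Rightarrow> ('v \<Rightarrow> real^'d) \<Rightarrow> 'v set \<Rightarrow> 'v set set" where
  "linked_edges E p W = {{u, v} | u v. u \<in> W \<and> v \<in> W \<and> u \<noteq> v \<and> linked E p u v}"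

lemma glued_clique_graph_linked:
  fixes p :: "'v::finite \<Rightarrow> real^'d"
  assumes p: "generic_placement p"
  shows "glued_clique_graph (linked E p) CARD('d)"
proof
  show "linked E p u v \<Longrightarrow> linked E p v u" for u v
    by (simp add: linked_def pair_row_commute)
  show "linked E p u u" for u
    by (simp add: linked_def span_zero)
next
  fix A B a b
  assume A: "\<forall>u\<in>A. \<forall>v\<in>A. linked E p u v" and B: "\<forall>u\<in>B. \<forall>v\<in>B. linked E p u v"
    and c: "CARD('d) \<le> card (A \<inter> B)" and ab: "a \<in> A" "b \<in> B"
  show "linked E p a b"
  proof (cases "a \<in> B \<or> b \<in> A")
    case False
    obtain C where C: "C \<subseteq> A \<inter> B" "card C = CARD('d)"
      using c by (meson obtain_subset_with_card_n)
    show ?thesis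
      unfolding linked_def
    proof (rule pair_row_glue[OF p C(2)])
      show "a \<notin> C" "b \<notin> C" "a \<noteq> b" using False C ab by auto
      show "pair_row p u v \<in> span (edge_row p ` E)" if "u \<in> insert a C" "v \<in> insert a C" for u v
        using A that C ab unfolding linked_def by blast
      show "pair_row p u v \<in> span (edge_row p ` E)" if "u \<in> insert b C" "v \<in> insert b C" for u v
        using B that C ab unfolding linked_def by blast
    qed simp
  qed (use A B ab in auto)
qed

lemma edge_row_cong:
  assumes "u \<noteq> w" "p u = q u" "p w = q w"
  shows "edge_row p {u, w} = edge_row q {u, w}"
  using assms by (simp add: edge_row_pair pair_row_def)

text \<open>In the columns of \<open>v\<close> the rows of \<open>F\<close> vanish, while the row of
  \<open>vu\<close> is \<open>q v - q u\<close>.\<close>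

lemma dim_add_star_ge:
  fixes q :: "'v::finite \<Rightarrow> real^'d"
  assumes F: "\<And>e. e \<in> F \<Longrightarrow> \<exists>u w. u \<noteq> w \<and> u \<noteq> v \<and> w \<noteq> v \<and> e = {u, w}"
    and T: "v \<notin> T" "indep_family T (\<lambda>u. q v - q u)"
  shows "dim (edge_row q ` F) + card T \<le> dim (edge_row q ` F \<union> (\<lambda>u. edge_row q {v, u}) ` T)"
proof (rule dim_Un_image_ge)
  show "linear (vertex_part v)" by (rule linear_vertex_part)
  fix x assume "x \<in> edge_row q ` F"
  then obtain u w where "u \<noteq> w" "u \<noteq> v" "w \<noteq> v" "x = edge_row q {u, w}" using F by blast
  then show "vertex_part v x = 0"
    by (simp add: edge_row_pair pair_row_def linear_add[OF linear_vertex_part] vertex_part_at_vertex)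
next
  have "vertex_part v (edge_row q {v, u}) = q v - q u" if "u \<in> T" for u
  proof -
    have "v \<noteq> u" using that T by auto
    then show ?thesis
      by (simp add: edge_row_pair pair_row_def linear_add[OF linear_vertex_part] vertex_part_at_vertex)
  qed
  then show "indep_family T (\<lambda>u. vertex_part v (edge_row q {v, u}))"
    using T(2) unfolding indep_family_def by (simp cong: sum.cong)
qed simp

text \<open>The 0-extension: up to \<open>d\<close> generic differences at \<open>v\<close> are
  independent.\<close>

lemma dim_linked_edges_extend:
  fixes p :: "'v::finite \<Rightarrow> real^'d"
  assumes p: "generic_placement p" and v: "v \<notin> W"
    and N: "N \<subseteq> W" "\<And>u. u \<in> N \<Longrightarrow> linked E p v u"
  shows "dim (edge_row p ` linked_edges E p W) + min (card N) CARD('d)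
    \<le> dim (edge_row p ` linked_edges E p (insert v W))"
proof -
  obtain T where T: "T \<subseteq> N" "card T = min (card N) CARD('d)"
    by (meson min.cobounded1 obtain_subset_with_card_n)
  have vT: "v \<notin> T" using T N v by auto
  have "dim (edge_row p ` linked_edges E p W) + card T
      \<le> dim (edge_row p ` linked_edges E p W \<union> (\<lambda>u. edge_row p {v, u}) ` T)"
  proof (rule dim_add_star_ge)
    show "\<exists>u w. u \<noteq> w \<and> u \<noteq> v \<and> w \<noteq> v \<and> e = {u, w}" if "e \<in> linked_edges E p W" for e
      using that v unfolding linked_edges_def by blast
    show "indep_family T (\<lambda>u. p v - p u)"
      using T vT by (intro indep_family_generic_differences[OF p]) auto
  qed (rule vT)
  also have "\<dots> \<le> dim (edge_row p ` linked_edges E p (insert v W))"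
  proof (rule dim_subset, safe)
    fix u assume u: "u \<in> T"
    have "{v, u} \<in> linked_edges E p (insert v W)"
      unfolding linked_edges_def using u T N vT by blast
    then show "edge_row p {v, u} \<in> edge_row p ` linked_edges E p (insert v W)" by blast
  next
    fix e assume "e \<in> linked_edges E p W"
    then have "e \<in> linked_edges E p (insert v W)" unfolding linked_edges_def by blast
    then show "edge_row p e \<in> edge_row p ` linked_edges E p (insert v W)" by blast
  qed
  finally show ?thesis using T by simp
qed

text \<open>Placing \<open>v\<close> at the midpoint of \<open>x\<close> and \<open>y\<close> puts the row of \<open>xy\<close> into the span of those of \<open>vx\<close> and \<open>vy\<close>.\<close>

lemma dim_linked_edges_extend_nonlinked:
  fixes p :: "'v::finite \<Rightarrow> real^'d"
  assumes p: "generic_placement p" and v: "v \<notin> W"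
    and N: "N \<subseteq> W" "\<And>u. u \<in> N \<Longrightarrow> linked E p v u" "CARD('d) < card N"
    and xy: "x \<in> N" "y \<in> N" "\<not> linked E p x y"
  shows "dim (edge_row p ` linked_edges E p W) + CARD('d) + 1
    \<le> dim (edge_row p ` linked_edges E p (insert v W))"
proof -
  let ?L = "linked_edges E p W" and ?L' = "linked_edges E p (insert v W)"
  have xney: "x \<noteq> y" using xy by (auto simp: linked_def span_zero)
  have "CARD('d) - 1 \<le> card (N - {x, y})"
    using N(3) xy xney by (simp add: card_Diff_subset)
  then obtain U where U: "U \<subseteq> N - {x, y}" "card U = CARD('d) - 1"
    by (meson obtain_subset_with_card_n)
  \<comment> \<open>The vertex \<open>y\<close> is left out: at the midpoint the rows of
    \<open>vx\<close> and \<open>vy\<close> agree up to sign in the columns of \<open>v\<close>. The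
    star over \<open>T\<close> yields \<open>d\<close>, and the row of \<open>xy\<close> the
    additional 1.\<close>
  define T where "T = insert x U"
  have xU: "x \<notin> U" "y \<notin> U" and vN: "v \<notin> N" using U v N by auto
  have cT: "card T = CARD('d)" using U xU by (simp add: T_def)
  have TN: "T \<subseteq> N" "y \<notin> T" using U xy xney by (auto simp: T_def)
  have vT: "v \<notin> T" and vxy: "v \<noteq> x" "v \<noteq> y" using TN vN xy by auto
  define q where "q = p(v := (1 / 2) *\<^sub>R (p x + p y))"
  have qv: "q v = (1 / 2) *\<^sub>R (p x + p y)" and q: "\<And>u. u \<noteq> v \<Longrightarrow> q u = p u" by (auto simp: q_def)
  define F where "F = insert {x, y} ?L"
  have F: "\<exists>u w. u \<noteq> w \<and> u \<noteq> v \<and> w \<noteq> v \<and> e = {u, w}" if "e \<in> F" for e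
    using that v xney vxy unfolding F_def linked_edges_def by blast
  have FE: "edge_row q ` F = edge_row p ` F"
  proof (rule image_cong[OF refl])
    fix e assume "e \<in> F"
    then obtain u w where "u \<noteq> w" "u \<noteq> v" "w \<noteq> v" "e = {u, w}" using F by blast
    then show "edge_row q e = edge_row p e" using q by (auto intro: edge_row_cong)
  qed
  have "edge_row p ` ?L \<subseteq> span (edge_row p ` E)"
    by (auto simp: linked_edges_def linked_def edge_row_pair)
  then have "span (edge_row p ` ?L) \<subseteq> span (edge_row p ` E)" by (simp add: span_minimal)
  then have "edge_row p {x, y} \<notin> span (edge_row p ` ?L)"
    using xy(3) xney by (auto simp: linked_def edge_row_pair)
  then have "dim (edge_row p ` F) = dim (edge_row p ` ?L) + 1"
    unfolding F_def by (simp add: dim_insert)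
  then have dimF: "dim (edge_row q ` F) = dim (edge_row p ` ?L) + 1" by (simp only: FE)
  have "indep_family T (\<lambda>u. q v - q u)"
    unfolding indep_family_def
  proof (intro allI impI)
    fix c assume c: "(\<Sum>u\<in>T. c u *\<^sub>R (q v - q u)) = 0"
    \<comment> \<open>Since \<open>q v - q x\<close> is half of \<open>p y - p x\<close>, these
      coefficients turn the dependence of the differences at \<open>q v\<close> into one of the
      generic differences at \<open>p y\<close>.\<close>
    define b where "b u = (if u = x then (c x - (\<Sum>u\<in>U. c u)) / 2 else c u)" for u
    have bU: "b u = c u" if "u \<in> U" for u using that xU by (auto simp: b_def)
    have qx: "q v - q x = (1 / 2) *\<^sub>R (p y - p x)"
      using q vxy by (simp add: qv vec_eq_iff field_simps)
    have qU: "q v - q u = (p y - p u) - (1 / 2) *\<^sub>R (p y - p x)" if "u \<in> U" for u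
    proof -
      have "u \<noteq> v" using that vT by (auto simp: T_def)
      then show ?thesis using q by (simp add: qv vec_eq_iff field_simps)
    qed
    have "(\<Sum>u\<in>T. b u *\<^sub>R (p y - p u))
        = ((c x - (\<Sum>u\<in>U. c u)) / 2) *\<^sub>R (p y - p x) + (\<Sum>u\<in>U. c u *\<^sub>R (p y - p u))"
      unfolding T_def using xU bU by (simp add: b_def[of x] cong: sum.cong)
    also have "\<dots> = c x *\<^sub>R ((1 / 2) *\<^sub>R (p y - p x))
        + ((\<Sum>u\<in>U. c u *\<^sub>R (p y - p u)) - (\<Sum>u\<in>U. c u) *\<^sub>R ((1 / 2) *\<^sub>R (p y - p x)))"
      by (simp add: diff_divide_distrib scaleR_left_diff_distrib)
    also have "\<dots> = c x *\<^sub>R ((1 / 2) *\<^sub>R (p y - p x))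
        + (\<Sum>u\<in>U. c u *\<^sub>R ((p y - p u) - (1 / 2) *\<^sub>R (p y - p x)))"
      by (simp only: scaleR_right_diff_distrib[of _ "p y - p _"] sum_subtractf scaleR_sum_left)
    also have "\<dots> = (\<Sum>u\<in>T. c u *\<^sub>R (q v - q u))"
      unfolding T_def using xU by (simp add: qx qU cong: sum.cong)
    finally have "(\<Sum>u\<in>T. b u *\<^sub>R (p y - p u)) = 0" using c by simp
    moreover have "indep_family T (\<lambda>u. p y - p u)"
      using cT TN by (intro indep_family_generic_differences[OF p]) auto
    ultimately have b0: "b u = 0" if "u \<in> T" for u using that by (intro indep_familyD)
    then have cU: "c u = 0" if "u \<in> U" for u using that bU[OF that] by (metis T_def insertI2)
    moreover have "c x = 0" using b0[of x] cU by (simp add: b_def T_def)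
    ultimately show "\<forall>u\<in>T. c u = 0" by (auto simp: T_def)
  qed
  then have "dim (edge_row q ` F) + card T \<le> dim (edge_row q ` F \<union> (\<lambda>u. edge_row q {v, u}) ` T)"
    by (intro dim_add_star_ge F vT)
  also have "\<dots> \<le> dim (span (edge_row q ` ?L'))"
  proof (rule dim_subset, rule Un_least)
    have star: "edge_row q {v, u} \<in> span (edge_row q ` ?L')" if "u \<in> N" for u
    proof -
      have "{v, u} \<in> ?L'" unfolding linked_edges_def using that N vN by blast
      then show ?thesis by (intro span_base imageI)
    qed
    then show "(\<lambda>u. edge_row q {v, u}) ` T \<subseteq> span (edge_row q ` ?L')" using TN by blast
    have "pair_row q v x + pair_row q v y = (1 / 2) *\<^sub>R pair_row q x y"
      using q vxy
      by (simp add: pair_row_def qv at_vertex_def vec_eq_iff field_simps)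
    then have "edge_row q {x, y} = 2 *\<^sub>R (edge_row q {v, x} + edge_row q {v, y})"
      using vxy xney by (simp add: edge_row_pair)
    then have "edge_row q {x, y} \<in> span (edge_row q ` ?L')"
      using star xy by (simp add: span_add span_scale del: scaleR_add_right)
    moreover have "?L \<subseteq> ?L'" unfolding linked_edges_def by blast
    ultimately show "edge_row q ` F \<subseteq> span (edge_row q ` ?L')"
      unfolding F_def by (auto intro: span_base)
  qed
  \<comment> \<open>The special placement \<open>q\<close> cannot exceed the generic rank.\<close>
  also have "\<dots> \<le> dim (edge_row p ` ?L')"
    using dim_edge_row_le_generic[OF p, of q ?L'] by simp
  finally show ?thesis unfolding dimF cT by simp
qed

section \<open>Rank bound for highly connected non-rigid graphs\<close>

theorem theorem5p2:
  fixes E :: "'v::finite set set" and d k :: nat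
  assumes "CARD('d::finite) = d" and "1 \<le> d"
    and "1 \<le> k" and "k < d * (d + 1)"
    and "simple_graph E"
    and "vertex_connected k E"
    and "\<not> rigid_graph TYPE('d) E"
  shows "real (rigidity_rank TYPE('d) E) \<ge> rank_density d k * real CARD('v)"
proof -
  \<comment> \<open>The same choice as in \<open>rigidity_rank\<close>, so the rank is literally the
    one at \<open>p\<close>.\<close>
  define p :: "'v \<Rightarrow> real^'d" where "p = (SOME p. generic_placement p)"
  have p: "generic_placement p" unfolding p_def by (rule someI_ex[OF ex_generic_placement])
  interpret glued_clique_graph "linked E p" d
    using glued_clique_graph_linked[OF p] assms(1) by simp
  define \<rho> where "\<rho> W = dim (edge_row p ` linked_edges E p W)" for W
  have pair: "\<exists>u v. u \<noteq> v \<and> e = {u, v}" if "e \<in> E" for e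
    using assms(5) that unfolding simple_graph_def card_2_iff by blast
  have edge_linked: "linked E p u v" if "{u, v} \<in> E" for u v
  proof -
    have "u \<noteq> v" using pair[OF that] by (auto simp: doubleton_eq_iff)
    then show ?thesis unfolding linked_def using that by (metis edge_row_pair imageI span_base)
  qed
  have rank: "rigidity_rank TYPE('d) E = \<rho> UNIV"
  proof -
    have "edge_row p ` linked_edges E p UNIV \<subseteq> span (edge_row p ` E)"
      by (auto simp: linked_edges_def linked_def edge_row_pair)
    moreover have "E \<subseteq> linked_edges E p UNIV"
      unfolding linked_edges_def using pair edge_linked by blast
    then have "edge_row p ` E \<subseteq> span (edge_row p ` linked_edges E p UNIV)"
      by (auto intro: span_base)
    ultimately have "span (edge_row p ` E) = span (edge_row p ` linked_edges E p UNIV)"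
      by (simp add: span_eq)
    then show ?thesis
      unfolding rigidity_rank_def p_def[symmetric] rank_rigidity_matrix \<rho>_def by (metis dim_span)
  qed
  have ext: "\<rho> W + gain (nbrs W v) \<le> \<rho> (insert v W)" if v: "v \<notin> W" for W v
  proof (cases "d < card (nbrs W v) \<and> \<not> clique (nbrs W v)")
    case True
    then obtain x y where "x \<in> nbrs W v" "y \<in> nbrs W v" "\<not> linked E p x y"
      unfolding clique_def by blast
    then have "\<rho> W + CARD('d) + 1 \<le> \<rho> (insert v W)"
      unfolding \<rho>_def using True assms(1)
      by (intro dim_linked_edges_extend_nonlinked[OF p v, of "nbrs W v" E x y])
        (auto simp: nbrs_def adj_sym)
    then show ?thesis using True assms(1) by (simp add: gain_def)
  next
    case False
    have "\<rho> W + min (card (nbrs W v)) CARD('d) \<le> \<rho> (insert v W)"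
      unfolding \<rho>_def by (rule dim_linked_edges_extend[OF p v]) (auto simp: nbrs_def adj_sym)
    then show ?thesis using False assms(1) by (auto simp: gain_def)
  qed
  have "cut_connected k UNIV"
    unfolding cut_connected_def
  proof (intro conjI allI impI)
    show "k < CARD('v)" using assms(6) by (simp add: vertex_connected_def)
    fix A B :: "'v set"
    assume ne: "A \<noteq> {}" "B \<noteq> {}" and sep: "\<forall>a\<in>A. \<forall>b\<in>B. \<not> linked E p a b"
    show "k \<le> card (UNIV - (A \<union> B))"
    proof (rule ccontr)
      assume "\<not> k \<le> card (UNIV - (A \<union> B))"
      then have "card (UNIV - (A \<union> B)) < k" by simp
      then have conn: "induced_connected E (- (UNIV - (A \<union> B)))"
        using assms(6) unfolding vertex_connected_def by blast
      obtain a b where ab: "a \<in> A" "b \<in> B" using ne by blast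
      let ?R = "{(x, y). x \<in> A \<union> B \<and> y \<in> A \<union> B \<and> {x, y} \<in> E}"
      have "- (UNIV - (A \<union> B)) = A \<union> B" by auto
      then have "(a, b) \<in> ?R\<^sup>*"
        using conn ab unfolding induced_connected_def by simp
      \<comment> \<open>Edges of \<open>E\<close> are linked, so no edge of the path crosses from
        \<open>A\<close> to \<open>B\<close>, and the path never leaves \<open>A\<close>.\<close>
      then have "b \<in> A"
      proof (induction rule: rtrancl_induct)
        case (step y z)
        then have "linked E p y z" using edge_linked by auto
        then show ?case using step sep by auto
      qed (rule ab)
      then show False using sep ab adj_refl by blast
    qed
  qed
  \<comment> \<open>If all pairs were linked, the rows of \<open>E\<close> would span every row, and
    \<open>p\<close> would be a rigid generic framework.\<close>
  moreover have "\<not> clique UNIV"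
  proof
    assume "clique UNIV"
    then have "rigid_framework E p"
      using assms(5) by (intro rigid_framework_if_rows_span[OF p]) (auto simp: clique_def linked_def)
    then show False using assms(7) p unfolding rigid_graph_def by blast
  qed
  ultimately show ?thesis
    unfolding rank using rank_ge_rank_density[OF ext assms(4), of UNIV] by simp
qed

end
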